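(* Let $\mathbb{F}$ be a field and $\Sigma$ a bialgebra over $\mathbb{F}$ whose underlying coalgebra is pointed with exhaustive coradical filtration. Let $G$ be a group with an injective algebra map $\mathbb{F}[G]\to\Sigma$ that maps $G$ bijectively onto the set of grouplike elements of $\Sigma$. Let $M$ be a right $\Sigma$-comodule $\mathbb{F}[G]$-algebra with coaction $\psi$, and suppose that $G$ is grouplike in $M$, i.e. $\psi(g)=g\otimes g$ for (the image in $M$ of) each $g\in G$. Let $f\colon M\to\Sigma$ be a map of $\Sigma$-comodules and of $\mathbb{F}[G]$-algebras which is $\star$-surjective. Then there is an isomorphism of right $\Sigma$-comodules $$h\colon M\longrightarrow P_1(M)\otimes\Sigma .$$
   Context: All tensor products are over $\mathbb{F}$. A coalgebra is pointed if all its simple subcoalgebras are $1$-dimensional; its coradical $R$ is then spanned by the grouplike elements. The coradical filtration of $\Sigma$ is $$F_k=\ker\bigl(\Sigma\to\Sigma^{\otimes(k+1)}\to(\Sigma/R)^{\otimes(k+1)}\bigr),\quad k\ge 0,$$ where the first map is the iterated coproduct; so $F_0=R$, and we put $F_{-1}=0$. It is exhaustive if every element lies in some $F_k$. A right $\Sigma$-comodule $\mathbb{F}[G]$-algebra $M$ is a unital associative $\mathbb{F}$-algebra with an algebra map $\mathbb{F}[G]\to M$ and a right $\Sigma$-comodule structure $\psi\colon M\to M\otimes\Sigma$ that is an algebra map. $\Sigma$ itself is a right comodule via its coproduct, with unit $1$. $P_1(M)=\{m\in M\mid\psi(m)=m\otimes 1\}$, and $P_1(M)\otimes\Sigma$ has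 coaction $\mathrm{id}\otimes\Delta$. The graded left primitives of a comodule $M$ with distinguished element $1$ (here the unit of the algebra) are $$\bar P_1Gr_k(M)=\{m\in M\mid \psi(m)\equiv 1\otimes\sigma \bmod M\otimes F_{k-1}\text{ for some }\sigma\in F_k\},\quad k\ge0.$$ A comodule map $f\colon M\to M'$ with $f(1)=1$ is $\star$-surjective if it is surjective and, for all $k\ge0$, the induced map $\bar P_1Gr_k(M)\to\bar P_1Gr_k(M')$ is surjective. *)

theory Defs
  imports Complex_Main "HOL-Library.Poly_Mapping" "HOL-Library.Set_Algebras"
begin

text \<open>
  Algebras over a field \<open>'k\<close> are types of class \<open>ring_1\<close> with an explicit scalar multiplication.
  Quotient spaces and tensor products depend on term parameters, so they are records with an
  explicit carrier. Their elements are cosets in an ambient vector space.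
\<close>

record ('k, 'v) vspace =
  vcarrier :: "'v set"
  vadd :: "'v \<Rightarrow> 'v \<Rightarrow> 'v"
  vzero :: "'v"
  vscale :: "'k \<Rightarrow> 'v \<Rightarrow> 'v"

definition subsp :: "('k \<Rightarrow> 'v \<Rightarrow> 'v) \<Rightarrow> 'v set \<Rightarrow> ('k, 'v::ab_group_add) vspace" where
  "subsp sc A = \<lparr>vcarrier = A, vadd = (+), vzero = 0, vscale = sc\<rparr>"

text \<open>The quotient \<open>A/U\<close> of a subspace \<open>A\<close> by a subspace \<open>U\<close> contained in it. Adding \<open>U\<close> in the
  scalar multiplication is needed for the scalar 0.\<close>

definition quot :: "('k \<Rightarrow> 'v \<Rightarrow> 'v) \<Rightarrow> 'v set \<Rightarrow> 'v set \<Rightarrow> ('k, 'v::ab_group_add set) vspace" where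
  "quot sc A U = \<lparr>vcarrier = (\<lambda>x. x +o U) ` A, vadd = (+), vzero = U,
                  vscale = (\<lambda>c X. sc c ` X + U)\<rparr>"

definition rep :: "'a set \<Rightarrow> 'a" where
  "rep X = (SOME x. x \<in> X)"

definition vlinear :: "('k, 'v, 'x) vspace_scheme \<Rightarrow> ('k, 'w, 'y) vspace_scheme \<Rightarrow> ('v \<Rightarrow> 'w) \<Rightarrow> bool"
  where
  "vlinear V W f \<longleftrightarrow>
     (\<forall>x\<in>vcarrier V. f x \<in> vcarrier W) \<and>
     (\<forall>x\<in>vcarrier V. \<forall>y\<in>vcarrier V. f (vadd V x y) = vadd W (f x) (f y)) \<and>
     (\<forall>c. \<forall>x\<in>vcarrier V. f (vscale V c x) = vscale W c (f x))"


section \<open>Free vector spaces\<close>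

text \<open>The free \<open>'k\<close>-vector space on \<open>'b\<close> is the type \<open>'b \<Rightarrow>\<^sub>0 'k\<close>. If \<open>'b\<close> is a group (written
  additively, class \<open>group_add\<close>, not assumed commutative), the ring structure of this type
  is that of the group algebra, with \<open>g\<close> embedded as \<open>bas g\<close>.\<close>

definition fscale :: "'k::field \<Rightarrow> ('b \<Rightarrow>\<^sub>0 'k) \<Rightarrow> ('b \<Rightarrow>\<^sub>0 'k)" where
  "fscale c p = Poly_Mapping.map ((*) c) p"

definition bas :: "'b \<Rightarrow> ('b \<Rightarrow>\<^sub>0 'k::field)" where
  "bas b = Poly_Mapping.single b 1"

lemma lookup_fscale [simp]: "Poly_Mapping.lookup (fscale c p) b = c * Poly_Mapping.lookup p b"
  unfolding fscale_def by transfer (auto simp: when_def)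

lemma vector_space_fscale: "vector_space (fscale :: 'k::field \<Rightarrow> ('b \<Rightarrow>\<^sub>0 'k) \<Rightarrow> _)"
  by unfold_locales (auto intro!: poly_mapping_eqI simp: lookup_add algebra_simps)

definition lin_ext :: "('k::field \<Rightarrow> 'c \<Rightarrow> 'c) \<Rightarrow> ('b \<Rightarrow> 'c::comm_monoid_add) \<Rightarrow> ('b \<Rightarrow>\<^sub>0 'k) \<Rightarrow> 'c" where
  "lin_ext sc \<phi> p = (\<Sum>b\<in>Poly_Mapping.keys p. sc (Poly_Mapping.lookup p b) (\<phi> b))"

abbreviation fspan :: "('b \<Rightarrow>\<^sub>0 'k::field) set \<Rightarrow> ('b \<Rightarrow>\<^sub>0 'k) set" where
  "fspan \<equiv> module.span fscale"

definition presented :: "'b set \<Rightarrow> ('b \<Rightarrow>\<^sub>0 'k::field) set \<Rightarrow> ('k, ('b \<Rightarrow>\<^sub>0 'k) set) vspace" where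
  "presented B Rel = quot fscale {p. Poly_Mapping.keys p \<subseteq> B} (fspan Rel)"


section \<open>Tensor products\<close>

definition tensor_rels ::
  "('k::field, 'v, 'x) vspace_scheme \<Rightarrow> ('k, 'w, 'y) vspace_scheme \<Rightarrow> (('v \<times> 'w) \<Rightarrow>\<^sub>0 'k) set" where
  "tensor_rels V W =
     {bas (vadd V v v', w) - bas (v, w) - bas (v', w) | v v' w.
        v \<in> vcarrier V \<and> v' \<in> vcarrier V \<and> w \<in> vcarrier W} \<union>
     {bas (v, vadd W w w') - bas (v, w) - bas (v, w') | v w w'.
        v \<in> vcarrier V \<and> w \<in> vcarrier W \<and> w' \<in> vcarrier W} \<union>
     {bas (vscale V c v, w) - fscale c (bas (v, w)) | c v w.
        v \<in> vcarrier V \<and> w \<in> vcarrier W} \<union>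
     {bas (v, vscale W c w) - fscale c (bas (v, w)) | c v w.
        v \<in> vcarrier V \<and> w \<in> vcarrier W}"

definition tensor ::
  "('k::field, 'v, 'x) vspace_scheme \<Rightarrow> ('k, 'w, 'y) vspace_scheme \<Rightarrow>
     ('k, (('v \<times> 'w) \<Rightarrow>\<^sub>0 'k) set) vspace" where
  "tensor V W = presented (vcarrier V \<times> vcarrier W) (tensor_rels V W)"

definition tcls ::
  "('k::field, 'v, 'x) vspace_scheme \<Rightarrow> ('k, 'w, 'y) vspace_scheme \<Rightarrow>
     (('v \<times> 'w) \<Rightarrow>\<^sub>0 'k) \<Rightarrow> (('v \<times> 'w) \<Rightarrow>\<^sub>0 'k) set" where
  "tcls V W p = p +o fspan (tensor_rels V W)"

definition pure ::
  "('k::field, 'v, 'x) vspace_scheme \<Rightarrow> ('k, 'w, 'y) vspace_scheme \<Rightarrow>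
     'v \<Rightarrow> 'w \<Rightarrow> (('v \<times> 'w) \<Rightarrow>\<^sub>0 'k) set" where
  "pure V W v w = tcls V W (bas (v, w))"

text \<open>The image of \<open>A \<otimes> B\<close> in \<open>V \<otimes> W\<close>, for subspaces \<open>A\<close> of \<open>V\<close> and \<open>B\<close> of \<open>W\<close>.\<close>

definition tensor_image ::
  "('k::field, 'v, 'x) vspace_scheme \<Rightarrow> ('k, 'w, 'y) vspace_scheme \<Rightarrow>
     'v set \<Rightarrow> 'w set \<Rightarrow> (('v \<times> 'w) \<Rightarrow>\<^sub>0 'k) set set" where
  "tensor_image V W A B = tcls V W ` {p. Poly_Mapping.keys p \<subseteq> A \<times> B}"

text \<open>The map \<open>f \<otimes> g\<close> into \<open>V' \<otimes> W'\<close>. This and the following maps on tensor products are computed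
  on a representing formal sum.\<close>

definition tmap ::
  "('k::field, 'v2, 'x) vspace_scheme \<Rightarrow> ('k, 'w2, 'y) vspace_scheme \<Rightarrow>
     ('v1 \<Rightarrow> 'v2) \<Rightarrow> ('w1 \<Rightarrow> 'w2) \<Rightarrow> (('v1 \<times> 'w1) \<Rightarrow>\<^sub>0 'k) set \<Rightarrow> (('v2 \<times> 'w2) \<Rightarrow>\<^sub>0 'k) set" where
  "tmap V' W' f g X = tcls V' W' (lin_ext fscale (\<lambda>(v, w). bas (f v, g w)) (rep X))"

text \<open>The associator \<open>V \<otimes> (W \<otimes> U) \<rightarrow> (V \<otimes> W) \<otimes> U\<close>.\<close>

definition tassoc ::
  "('k::field, 'v, 'x) vspace_scheme \<Rightarrow> ('k, 'w, 'y) vspace_scheme \<Rightarrow> ('k, 'u, 'z) vspace_scheme \<Rightarrow>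
     (('v \<times> (('w \<times> 'u) \<Rightarrow>\<^sub>0 'k) set) \<Rightarrow>\<^sub>0 'k) set \<Rightarrow> (((('v \<times> 'w) \<Rightarrow>\<^sub>0 'k) set \<times> 'u) \<Rightarrow>\<^sub>0 'k) set" where
  "tassoc V W U X = tcls (tensor V W) U
     (lin_ext fscale
        (\<lambda>(v, Y). lin_ext fscale (\<lambda>(w, u). bas (pure V W v w, u)) (rep Y)) (rep X))"

text \<open>The product \<open>(a \<otimes> b) (c \<otimes> d) = a c \<otimes> b d\<close> of the tensor product of two algebras.\<close>

definition tmult ::
  "('k::field \<Rightarrow> 'a \<Rightarrow> 'a) \<Rightarrow> ('k \<Rightarrow> 'b \<Rightarrow> 'b) \<Rightarrow> (('a::ring_1 \<times> 'b::ring_1) \<Rightarrow>\<^sub>0 'k) set \<Rightarrow>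
     (('a \<times> 'b) \<Rightarrow>\<^sub>0 'k) set \<Rightarrow> (('a \<times> 'b) \<Rightarrow>\<^sub>0 'k) set" where
  "tmult scA scB X Y = tcls (subsp scA UNIV) (subsp scB UNIV)
     (lin_ext fscale
        (\<lambda>(a, b). lin_ext fscale (\<lambda>(c, d). bas (a * c, b * d)) (rep Y)) (rep X))"

text \<open>The \<open>n\<close>-fold tensor power, with the list \<open>[v\<^sub>1, \<dots>, v\<^sub>n]\<close> standing for \<open>v\<^sub>1 \<otimes> \<dots> \<otimes> v\<^sub>n\<close>.\<close>

definition tpow_rels :: "nat \<Rightarrow> ('k::field, 'v, 'x) vspace_scheme \<Rightarrow> ('v list \<Rightarrow>\<^sub>0 'k) set" where
  "tpow_rels n V =
     {bas (l[i := vadd V x y]) - bas (l[i := x]) - bas (l[i := y]) | l i x y.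
        length l = n \<and> set l \<subseteq> vcarrier V \<and> i < n \<and> x \<in> vcarrier V \<and> y \<in> vcarrier V} \<union>
     {bas (l[i := vscale V c x]) - fscale c (bas (l[i := x])) | l i c x.
        length l = n \<and> set l \<subseteq> vcarrier V \<and> i < n \<and> x \<in> vcarrier V}"

definition tpow :: "nat \<Rightarrow> ('k::field, 'v, 'x) vspace_scheme \<Rightarrow> ('k, ('v list \<Rightarrow>\<^sub>0 'k) set) vspace" where
  "tpow n V = presented {l. length l = n \<and> set l \<subseteq> vcarrier V} (tpow_rels n V)"

definition tpow_cls ::
  "nat \<Rightarrow> ('k::field, 'v, 'x) vspace_scheme \<Rightarrow> ('v list \<Rightarrow>\<^sub>0 'k) \<Rightarrow> ('v list \<Rightarrow>\<^sub>0 'k) set" where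
  "tpow_cls n V p = p +o fspan (tpow_rels n V)"

text \<open>The map \<open>f \<otimes> \<dots> \<otimes> f\<close> into the \<open>n\<close>-fold tensor power of \<open>V'\<close>.\<close>

definition tpow_map ::
  "nat \<Rightarrow> ('k::field, 'w, 'x) vspace_scheme \<Rightarrow> ('v \<Rightarrow> 'w) \<Rightarrow>
     ('v list \<Rightarrow>\<^sub>0 'k) set \<Rightarrow> ('w list \<Rightarrow>\<^sub>0 'k) set" where
  "tpow_map n V' f X = tpow_cls n V' (lin_ext fscale (\<lambda>l. bas (map f l)) (rep X))"


section \<open>Bialgebras\<close>

abbreviation whole :: "('k \<Rightarrow> 'v \<Rightarrow> 'v) \<Rightarrow> ('k, 'v::ab_group_add) vspace" where
  "whole sc \<equiv> subsp sc UNIV"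

locale unital_algebra = vector_space sc
  for sc :: "'k::field \<Rightarrow> 'a::ring_1 \<Rightarrow> 'a" +
  assumes scale_mult_left: "sc c x * y = sc c (x * y)"
    and scale_mult_right: "x * sc c y = sc c (x * y)"

definition algebra_map ::
  "('k::field \<Rightarrow> 'a::ring_1 \<Rightarrow> 'a) \<Rightarrow> ('k \<Rightarrow> 'b::ring_1 \<Rightarrow> 'b) \<Rightarrow> ('a \<Rightarrow> 'b) \<Rightarrow> bool" where
  "algebra_map scA scB f \<longleftrightarrow>
     Vector_Spaces.linear scA scB f \<and> f 1 = 1 \<and> (\<forall>x y. f (x * y) = f x * f y)"

locale coalgebra = vector_space sc
  for sc :: "'k::field \<Rightarrow> 's::ab_group_add \<Rightarrow> 's"
    and \<Delta> :: "'s \<Rightarrow> (('s \<times> 's) \<Rightarrow>\<^sub>0 'k) set"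
    and \<epsilon> :: "'s \<Rightarrow> 'k" +
  assumes comult_linear: "vlinear (whole sc) (tensor (whole sc) (whole sc)) \<Delta>"
    and counit_linear: "Vector_Spaces.linear sc (*) \<epsilon>"
    and coassoc:
      "tmap (tensor (whole sc) (whole sc)) (whole sc) \<Delta> id (\<Delta> x) =
       tassoc (whole sc) (whole sc) (whole sc)
         (tmap (whole sc) (tensor (whole sc) (whole sc)) id \<Delta> (\<Delta> x))"
    and counit_left: "lin_ext sc (\<lambda>(a, b). sc (\<epsilon> a) b) (rep (\<Delta> x)) = x"
    and counit_right: "lin_ext sc (\<lambda>(a, b). sc (\<epsilon> b) a) (rep (\<Delta> x)) = x"

locale bialgebra = unital_algebra sc + coalgebra sc \<Delta> \<epsilon>
  for sc :: "'k::field \<Rightarrow> 's::ring_1 \<Rightarrow> 's"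
    and \<Delta> :: "'s \<Rightarrow> (('s \<times> 's) \<Rightarrow>\<^sub>0 'k) set"
    and \<epsilon> :: "'s \<Rightarrow> 'k" +
  assumes comult_one: "\<Delta> 1 = pure (whole sc) (whole sc) 1 1"
    and comult_mult: "\<Delta> (x * y) = tmult sc sc (\<Delta> x) (\<Delta> y)"
    and counit_one: "\<epsilon> 1 = 1"
    and counit_mult: "\<epsilon> (x * y) = \<epsilon> x * \<epsilon> y"

definition grouplikes ::
  "('k::field \<Rightarrow> 's::ab_group_add \<Rightarrow> 's) \<Rightarrow> ('s \<Rightarrow> (('s \<times> 's) \<Rightarrow>\<^sub>0 'k) set) \<Rightarrow> ('s \<Rightarrow> 'k) \<Rightarrow> 's set"
  where
  "grouplikes sc \<Delta> \<epsilon> = {x. \<Delta> x = pure (whole sc) (whole sc) x x \<and> \<epsilon> x = 1}"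

definition subcoalgebra ::
  "('k::field \<Rightarrow> 's::ab_group_add \<Rightarrow> 's) \<Rightarrow> ('s \<Rightarrow> (('s \<times> 's) \<Rightarrow>\<^sub>0 'k) set) \<Rightarrow> 's set \<Rightarrow> bool" where
  "subcoalgebra sc \<Delta> C \<longleftrightarrow>
     module.subspace sc C \<and> \<Delta> ` C \<subseteq> tensor_image (whole sc) (whole sc) C C"

definition simple_subcoalgebra ::
  "('k::field \<Rightarrow> 's::ab_group_add \<Rightarrow> 's) \<Rightarrow> ('s \<Rightarrow> (('s \<times> 's) \<Rightarrow>\<^sub>0 'k) set) \<Rightarrow> 's set \<Rightarrow> bool" where
  "simple_subcoalgebra sc \<Delta> C \<longleftrightarrow>
     subcoalgebra sc \<Delta> C \<and> C \<noteq> {0} \<and>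
     (\<forall>D. subcoalgebra sc \<Delta> D \<and> D \<subseteq> C \<longrightarrow> D = {0} \<or> D = C)"

definition pointed ::
  "('k::field \<Rightarrow> 's::ab_group_add \<Rightarrow> 's) \<Rightarrow> ('s \<Rightarrow> (('s \<times> 's) \<Rightarrow>\<^sub>0 'k) set) \<Rightarrow> bool" where
  "pointed sc \<Delta> \<longleftrightarrow> (\<forall>C. simple_subcoalgebra sc \<Delta> C \<longrightarrow> vector_space.dim sc C = 1)"

text \<open>The coradical is the sum of all simple subcoalgebras.\<close>

definition coradical ::
  "('k::field \<Rightarrow> 's::ab_group_add \<Rightarrow> 's) \<Rightarrow> ('s \<Rightarrow> (('s \<times> 's) \<Rightarrow>\<^sub>0 'k) set) \<Rightarrow> 's set" where
  "coradical sc \<Delta> = module.span sc (\<Union> {C. simple_subcoalgebra sc \<Delta> C})"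

text \<open>\<open>iter_comult sc \<Delta> k\<close> is the iterated coproduct into the \<open>(k+1)\<close>-fold tensor power, where
  the coproduct is iterated on the left tensor factor.\<close>

primrec iter_comult ::
  "('k::field \<Rightarrow> 's::ab_group_add \<Rightarrow> 's) \<Rightarrow> ('s \<Rightarrow> (('s \<times> 's) \<Rightarrow>\<^sub>0 'k) set) \<Rightarrow> nat \<Rightarrow>
     's \<Rightarrow> ('s list \<Rightarrow>\<^sub>0 'k) set" where
  "iter_comult sc \<Delta> 0 = (\<lambda>x. tpow_cls 1 (whole sc) (bas [x]))"
| "iter_comult sc \<Delta> (Suc k) = (\<lambda>x. tpow_cls (k + 2) (whole sc)
     (lin_ext fscale
        (\<lambda>(a, b). lin_ext fscale (\<lambda>l. bas (l @ [b])) (rep (iter_comult sc \<Delta> k a))) (rep (\<Delta> x))))"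

definition corad_filt ::
  "('k::field \<Rightarrow> 's::ab_group_add \<Rightarrow> 's) \<Rightarrow> ('s \<Rightarrow> (('s \<times> 's) \<Rightarrow>\<^sub>0 'k) set) \<Rightarrow> nat \<Rightarrow> 's set" where
  "corad_filt sc \<Delta> k =
     (let Q = quot sc UNIV (coradical sc \<Delta>) in
      {x. tpow_map (k + 1) Q (\<lambda>y. y +o coradical sc \<Delta>) (iter_comult sc \<Delta> k x)
            = vzero (tpow (k + 1) Q)})"

text \<open>\<open>corad_filt_pred sc \<Delta> k\<close> is \<open>F\<^bsub>k-1\<^esub>\<close>, with \<open>F\<^bsub>-1\<^esub> = 0\<close>.\<close>

definition corad_filt_pred ::
  "('k::field \<Rightarrow> 's::ab_group_add \<Rightarrow> 's) \<Rightarrow> ('s \<Rightarrow> (('s \<times> 's) \<Rightarrow>\<^sub>0 'k) set) \<Rightarrow> nat \<Rightarrow> 's set" where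
  "corad_filt_pred sc \<Delta> k = (case k of 0 \<Rightarrow> {0} | Suc j \<Rightarrow> corad_filt sc \<Delta> j)"

definition exhaustive_corad_filt ::
  "('k::field \<Rightarrow> 's::ab_group_add \<Rightarrow> 's) \<Rightarrow> ('s \<Rightarrow> (('s \<times> 's) \<Rightarrow>\<^sub>0 'k) set) \<Rightarrow> bool" where
  "exhaustive_corad_filt sc \<Delta> \<longleftrightarrow> (\<forall>x. \<exists>k. x \<in> corad_filt sc \<Delta> k)"


section \<open>Comodules and comodule algebras\<close>

locale right_comodule = \<Sigma>: coalgebra sc \<Delta> \<epsilon> + M: vector_space scM
  for sc :: "'k::field \<Rightarrow> 's::ab_group_add \<Rightarrow> 's"
    and \<Delta> :: "'s \<Rightarrow> (('s \<times> 's) \<Rightarrow>\<^sub>0 'k) set"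
    and \<epsilon> :: "'s \<Rightarrow> 'k"
    and scM :: "'k \<Rightarrow> 'm::ab_group_add \<Rightarrow> 'm"
    and \<psi> :: "'m \<Rightarrow> (('m \<times> 's) \<Rightarrow>\<^sub>0 'k) set" +
  assumes coact_linear: "vlinear (whole scM) (tensor (whole scM) (whole sc)) \<psi>"
    and coact_coassoc:
      "tmap (tensor (whole scM) (whole sc)) (whole sc) \<psi> id (\<psi> m) =
       tassoc (whole scM) (whole sc) (whole sc)
         (tmap (whole scM) (tensor (whole sc) (whole sc)) id \<Delta> (\<psi> m))"
    and coact_counit: "lin_ext scM (\<lambda>(a, b). scM (\<epsilon> b) a) (rep (\<psi> m)) = m"

text \<open>A right comodule algebra over the group algebra of \<open>'g\<close>; \<open>\<eta>\<close> is its structure map.\<close>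

locale comodule_group_algebra =
  \<Sigma>: bialgebra sc \<Delta> \<epsilon> + M: unital_algebra scM + right_comodule sc \<Delta> \<epsilon> scM \<psi>
  for sc :: "'k::field \<Rightarrow> 's::ring_1 \<Rightarrow> 's"
    and \<Delta> :: "'s \<Rightarrow> (('s \<times> 's) \<Rightarrow>\<^sub>0 'k) set"
    and \<epsilon> :: "'s \<Rightarrow> 'k"
    and scM :: "'k \<Rightarrow> 'm::ring_1 \<Rightarrow> 'm"
    and \<psi> :: "'m \<Rightarrow> (('m \<times> 's) \<Rightarrow>\<^sub>0 'k) set"
    and \<eta> :: "('g::group_add \<Rightarrow>\<^sub>0 'k) \<Rightarrow> 'm" +
  assumes coact_one: "\<psi> 1 = pure (whole scM) (whole sc) 1 1"
    and coact_mult: "\<psi> (x * y) = tmult scM sc (\<psi> x) (\<psi> y)"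
    and structure_map: "algebra_map fscale scM \<eta>"

definition comodule_map ::
  "('k::field \<Rightarrow> 's::ab_group_add \<Rightarrow> 's) \<Rightarrow>
     ('k, 'v, 'x) vspace_scheme \<Rightarrow> ('v \<Rightarrow> (('v \<times> 's) \<Rightarrow>\<^sub>0 'k) set) \<Rightarrow>
     ('k, 'w, 'y) vspace_scheme \<Rightarrow> ('w \<Rightarrow> (('w \<times> 's) \<Rightarrow>\<^sub>0 'k) set) \<Rightarrow> ('v \<Rightarrow> 'w) \<Rightarrow> bool" where
  "comodule_map sc V \<rho> W \<rho>' f \<longleftrightarrow>
     vlinear V W f \<and> (\<forall>v\<in>vcarrier V. \<rho>' (f v) = tmap W (whole sc) f id (\<rho> v))"

definition comodule_iso ::
  "('k::field \<Rightarrow> 's::ab_group_add \<Rightarrow> 's) \<Rightarrow>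
     ('k, 'v, 'x) vspace_scheme \<Rightarrow> ('v \<Rightarrow> (('v \<times> 's) \<Rightarrow>\<^sub>0 'k) set) \<Rightarrow>
     ('k, 'w, 'y) vspace_scheme \<Rightarrow> ('w \<Rightarrow> (('w \<times> 's) \<Rightarrow>\<^sub>0 'k) set) \<Rightarrow> ('v \<Rightarrow> 'w) \<Rightarrow> bool" where
  "comodule_iso sc V \<rho> W \<rho>' f \<longleftrightarrow>
     comodule_map sc V \<rho> W \<rho>' f \<and> bij_betw f (vcarrier V) (vcarrier W)"

text \<open>The coaction \<open>id \<otimes> \<Delta>\<close> on \<open>V \<otimes> \<Sigma>\<close>, with values in \<open>(V \<otimes> \<Sigma>) \<otimes> \<Sigma>\<close>.\<close>

definition cofree_coaction ::
  "('k::field \<Rightarrow> 's::ab_group_add \<Rightarrow> 's) \<Rightarrow> ('s \<Rightarrow> (('s \<times> 's) \<Rightarrow>\<^sub>0 'k) set) \<Rightarrow>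
     ('k, 'v, 'x) vspace_scheme \<Rightarrow> (('v \<times> 's) \<Rightarrow>\<^sub>0 'k) set \<Rightarrow>
     (((('v \<times> 's) \<Rightarrow>\<^sub>0 'k) set \<times> 's) \<Rightarrow>\<^sub>0 'k) set" where
  "cofree_coaction sc \<Delta> V X =
     tassoc V (whole sc) (whole sc) (tmap V (tensor (whole sc) (whole sc)) id \<Delta> X)"

definition primitives ::
  "('k::field \<Rightarrow> 's::ring_1 \<Rightarrow> 's) \<Rightarrow> ('k \<Rightarrow> 'm::ab_group_add \<Rightarrow> 'm) \<Rightarrow>
     ('m \<Rightarrow> (('m \<times> 's) \<Rightarrow>\<^sub>0 'k) set) \<Rightarrow> 'm set" where
  "primitives sc scM \<psi> = {m. \<psi> m = pure (whole scM) (whole sc) m 1}"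

definition graded_left_primitives ::
  "('k::field \<Rightarrow> 's::ab_group_add \<Rightarrow> 's) \<Rightarrow> ('s \<Rightarrow> (('s \<times> 's) \<Rightarrow>\<^sub>0 'k) set) \<Rightarrow>
     ('k \<Rightarrow> 'm::ab_group_add \<Rightarrow> 'm) \<Rightarrow> ('m \<Rightarrow> (('m \<times> 's) \<Rightarrow>\<^sub>0 'k) set) \<Rightarrow> 'm \<Rightarrow> nat \<Rightarrow> 'm set" where
  "graded_left_primitives sc \<Delta> scM \<psi> e k =
     {m. \<exists>\<sigma>\<in>corad_filt sc \<Delta> k.
         \<exists>T\<in>tensor_image (whole scM) (whole sc) UNIV (corad_filt_pred sc \<Delta> k).
           \<psi> m = vadd (tensor (whole scM) (whole sc)) (pure (whole scM) (whole sc) e \<sigma>) T}"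

text \<open>A comodule map \<open>f\<close> with \<open>f e = e'\<close> sends graded left primitives to graded left primitives.
  The induced maps are thus restrictions of \<open>f\<close>.\<close>

definition star_surjective ::
  "('k::field \<Rightarrow> 's::ab_group_add \<Rightarrow> 's) \<Rightarrow> ('s \<Rightarrow> (('s \<times> 's) \<Rightarrow>\<^sub>0 'k) set) \<Rightarrow>
     ('k \<Rightarrow> 'm::ab_group_add \<Rightarrow> 'm) \<Rightarrow> ('m \<Rightarrow> (('m \<times> 's) \<Rightarrow>\<^sub>0 'k) set) \<Rightarrow> 'm \<Rightarrow>
     ('k \<Rightarrow> 'n::ab_group_add \<Rightarrow> 'n) \<Rightarrow> ('n \<Rightarrow> (('n \<times> 's) \<Rightarrow>\<^sub>0 'k) set) \<Rightarrow> 'n \<Rightarrow> ('m \<Rightarrow> 'n) \<Rightarrow> bool"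
  where
  "star_surjective sc \<Delta> scM \<psi> e scN \<psi>' e' f \<longleftrightarrow>
     comodule_map sc (whole scM) \<psi> (whole scN) \<psi>' f \<and> f e = e' \<and> surj f \<and>
     (\<forall>k. f ` graded_left_primitives sc \<Delta> scM \<psi> e k = graded_left_primitives sc \<Delta> scN \<psi>' e' k)"

end

theory Submission
  imports Defs
begin

text \<open>
  A comodule map from \<open>M\<close> to the cofree comodule \<open>P \<otimes> \<Sigma>\<close>, where \<open>P = P\<^sub>1(M)\<close>, is the same as a linear
  map \<open>\<phi>\<close> from \<open>M\<close> to \<open>P\<close>: it is \<open>h = (\<phi> \<otimes> id) \<circ> \<psi>\<close> (lemma \<open>cofree_comodule_map\<close>). Every \<open>\<phi>\<close> that satisfies
  \<open>\<phi>(p g) = p\<close> for \<open>p\<close> in \<open>P\<close> and \<open>g\<close> in \<open>G\<close> gives an isomorphism (lemma \<open>retraction_iso\<close>), and such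
  a \<open>\<phi>\<close> exists because each \<open>g\<close> is invertible and grouplike in \<open>M\<close> (lemma \<open>retraction_exists\<close>).

  Coefficients are handled by duality. The functionals on \<open>\<Sigma>\<close> act on \<open>M\<close> by \<open>\<beta> \<cdot> m = (id \<otimes> \<beta>)(\<psi>(m))\<close>, which
  makes \<open>M\<close> a module over the dual algebra, and elements of a tensor product are separated by
  functionals on one factor, also modulo a subspace (lemma \<open>tensor_separation\<close>). Let \<open>I\<close> be the ideal of
  functionals vanishing on the grouplike elements. As \<open>\<Sigma>\<close> is pointed, its coradical is spanned by
  the grouplike elements, and \<open>F\<^sub>k\<close> is the set of elements killed by \<open>I\<^bsup>k+1\<^esup>\<close> (lemma
  \<open>corad_filt_pointed\<close>). From this description it is clear that the filtration is stable under
  translation by grouplike elements, and that contracting an element of \<open>F\<^sub>k\<close> with a functional in \<open>I\<close>,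
  on either side of the coproduct, gives an element of \<open>F\<^bsub>k-1\<^esub>\<close>.

  Injectivity. Let \<open>h(m) = 0\<close>, that is, \<open>\<phi>(\<beta> \<cdot> m) = 0\<close> for all \<open>\<beta>\<close>. Some power of \<open>I\<close> kills \<open>m\<close>, since the
  filtration is exhaustive. By induction on the exponent \<open>I\<close> itself kills \<open>m\<close>. Then \<open>m\<close> is a sum of
  elements \<open>m\<^sub>g\<close> with \<open>\<psi>(m\<^sub>g) = m\<^sub>g \<otimes> g\<close>, each of the form \<open>\<beta> \<cdot> m\<close>. Each of these is \<open>p g\<close> with \<open>p\<close> in \<open>P\<close>, so
  \<open>0 = \<phi>(m\<^sub>g) = p\<close> and \<open>m = 0\<close>.

  Surjectivity. By induction on \<open>k\<close>, all \<open>p \<otimes> x\<close> with \<open>x\<close> in \<open>F\<^sub>k\<close> are in the image. Modulo \<open>F\<^bsub>k-1\<^esub>\<close> the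
  element \<open>x\<close> is a sum of components \<open>x\<^sub>g\<close> with \<open>\<Delta>(x\<^sub>g) \<equiv> g \<otimes> x\<^sub>g\<close> modulo \<open>\<Sigma> \<otimes> F\<^bsub>k-1\<^esub>\<close>, and then
  \<open>g\<^sup>-\<^sup>1 x\<^sub>g\<close> is a graded left primitive (lemma \<open>graded_left_primitive_component\<close>). The surjectivity of
  \<open>f\<close> on graded left primitives lifts it to some \<open>m\<close> with \<open>\<psi>(m) \<equiv> 1 \<otimes> \<sigma>\<close> modulo \<open>M \<otimes> F\<^bsub>k-1\<^esub>\<close>, where
  \<open>\<sigma> \<equiv> g\<^sup>-\<^sup>1 x\<^sub>g\<close> modulo \<open>F\<^bsub>k-1\<^esub>\<close>. So \<open>h(p g m) \<equiv> \<phi>(p g) \<otimes> x\<^sub>g = p \<otimes> x\<^sub>g\<close> modulo \<open>P \<otimes> F\<^bsub>k-1\<^esub>\<close>, which is in the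
  image by the induction hypothesis.
\<close>

section \<open>Linear extension from free vector spaces\<close>

interpretation fs: vector_space "fscale :: 'k::field \<Rightarrow> ('b \<Rightarrow>\<^sub>0 'k) \<Rightarrow> _"
  by (rule vector_space_fscale)

interpretation fld: vector_space "(*) :: 'k::field \<Rightarrow> 'k \<Rightarrow> 'k"
  by unfold_locales (auto simp: algebra_simps)

lemma lin_ext_superset:
  assumes "vector_space sc" "finite A" "Poly_Mapping.keys p \<subseteq> A"
  shows "lin_ext sc \<phi> p = (\<Sum>b\<in>A. sc (Poly_Mapping.lookup p b) (\<phi> b))"
proof -
  interpret vector_space sc by fact
  show ?thesis unfolding lin_ext_def
    by (rule sum.mono_neutral_left) (use assms in \<open>auto simp: in_keys_iff\<close>)
qed

lemma lin_ext_add: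
  assumes "vector_space sc"
  shows "lin_ext sc \<phi> (p + q) = lin_ext sc \<phi> p + lin_ext sc \<phi> q"
proof -
  interpret vector_space sc by fact
  let ?A = "Poly_Mapping.keys p \<union> Poly_Mapping.keys q"
  have "Poly_Mapping.keys (p + q) \<subseteq> ?A" by (rule keys_add)
  then show ?thesis
    by (simp add: lin_ext_superset[OF assms, of ?A] lookup_add scale_left_distrib sum.distrib)
qed

lemma lin_ext_scale:
  assumes "vector_space sc"
  shows "lin_ext sc \<phi> (fscale c p) = sc c (lin_ext sc \<phi> p)"
proof -
  interpret vector_space sc by fact
  have "Poly_Mapping.keys (fscale c p) \<subseteq> Poly_Mapping.keys p" by (auto simp: in_keys_iff)
  then show ?thesis
    by (simp add: lin_ext_superset[OF assms, of "Poly_Mapping.keys p"] scale_sum_right)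
qed

lemma lin_ext_linear: "vector_space sc \<Longrightarrow> Vector_Spaces.linear fscale sc (lin_ext sc \<phi>)"
  by (simp add: Vector_Spaces.linear_iff lin_ext_add lin_ext_scale vector_space_fscale)

lemma lin_ext_diff:
  assumes "vector_space sc"
  shows "lin_ext sc \<phi> (p - q) = lin_ext sc \<phi> p - lin_ext sc \<phi> q"
proof -
  interpret Vector_Spaces.linear fscale sc "lin_ext sc \<phi>" by (rule lin_ext_linear[OF assms])
  show ?thesis by (rule diff)
qed

lemma lin_ext_bas [simp]:
  assumes "vector_space sc" shows "lin_ext sc \<phi> (bas b) = \<phi> b"
proof -
  interpret vector_space sc by fact
  show ?thesis by (simp add: lin_ext_def bas_def)
qed

lemma lin_ext_zero [simp]: "lin_ext sc \<phi> 0 = 0"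
  by (simp add: lin_ext_def)

lemma linear_lin_ext:
  assumes "Vector_Spaces.linear sc sc' F"
  shows "F (lin_ext sc \<phi> p) = lin_ext sc' (\<lambda>b. F (\<phi> b)) p"
proof -
  interpret Vector_Spaces.linear sc sc' F by fact
  show ?thesis by (simp add: lin_ext_def sum scale)
qed

lemma lin_ext_lin_ext:
  assumes "vector_space sc"
  shows "lin_ext sc \<phi> (lin_ext fscale \<theta> p) = lin_ext sc (\<lambda>b. lin_ext sc \<phi> (\<theta> b)) p"
  by (rule linear_lin_ext[OF lin_ext_linear[OF assms]])

lemma lin_ext_cong:
  "(\<And>b. b \<in> Poly_Mapping.keys p \<Longrightarrow> \<phi> b = \<theta> b) \<Longrightarrow> lin_ext sc \<phi> p = lin_ext sc \<theta> p"
  by (simp add: lin_ext_def)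

lemma lin_ext_fun_add:
  assumes "vector_space sc"
  shows "lin_ext sc (\<lambda>b. \<phi> b + \<theta> b) p = lin_ext sc \<phi> p + lin_ext sc \<theta> p"
proof -
  interpret vector_space sc by fact
  show ?thesis by (simp add: lin_ext_def scale_right_distrib sum.distrib)
qed

lemma lin_ext_fun_diff:
  assumes "vector_space sc"
  shows "lin_ext sc (\<lambda>b. \<phi> b - \<theta> b) p = lin_ext sc \<phi> p - lin_ext sc \<theta> p"
proof -
  interpret vector_space sc by fact
  show ?thesis by (simp add: lin_ext_def scale_right_diff_distrib sum_subtractf)
qed

lemma lin_ext_fun_scale:
  assumes "vector_space sc"
  shows "lin_ext sc (\<lambda>b. sc c (\<phi> b)) p = sc c (lin_ext sc \<phi> p)"
proof -
  interpret vector_space sc by fact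
  show ?thesis by (simp add: lin_ext_def scale_sum_right mult.commute)
qed

lemma lin_ext_fun_sum:
  assumes "vector_space sc"
  shows "lin_ext sc (\<lambda>b. \<Sum>a\<in>A. \<phi> a b) p = (\<Sum>a\<in>A. lin_ext sc (\<phi> a) p)"
proof -
  interpret vector_space sc by fact
  show ?thesis unfolding lin_ext_def by (subst sum.swap) (simp add: scale_sum_right)
qed

lemma lin_ext_in_subspace:
  assumes "vector_space sc" "module.subspace sc S" "\<And>b. b \<in> Poly_Mapping.keys p \<Longrightarrow> \<phi> b \<in> S"
  shows "lin_ext sc \<phi> p \<in> S"
proof -
  interpret vector_space sc by fact
  show ?thesis unfolding lin_ext_def
    by (intro subspace_sum[OF assms(2)] subspace_scale[OF assms(2)] assms(3))
qed

lemma lin_ext_bas_self: "lin_ext fscale bas p = p"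
proof -
  have "lin_ext fscale bas p = (\<Sum>b\<in>Poly_Mapping.keys p. Poly_Mapping.single b (Poly_Mapping.lookup p b))"
    unfolding lin_ext_def
    by (rule sum.cong) (auto intro!: poly_mapping_eqI simp: bas_def lookup_single when_def)
  also have "\<dots> = p"
    by (rule poly_mapping_eqI)
      (auto simp: lookup_sum lookup_single when_def not_in_keys_iff_lookup_eq_zero)
  finally show ?thesis .
qed

lemma subspace_keys: "module.subspace fscale {p :: 'b \<Rightarrow>\<^sub>0 'k::field. Poly_Mapping.keys p \<subseteq> A}"
proof (rule fs.subspaceI)
  show "x + y \<in> {p. Poly_Mapping.keys p \<subseteq> A}"
    if "x \<in> {p. Poly_Mapping.keys p \<subseteq> A}" "y \<in> {p. Poly_Mapping.keys p \<subseteq> A}" for x y :: "'b \<Rightarrow>\<^sub>0 'k"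
    using that keys_add[of x y] by blast
  show "fscale c x \<in> {p. Poly_Mapping.keys p \<subseteq> A}" if "x \<in> {p. Poly_Mapping.keys p \<subseteq> A}"
    for c and x :: "'b \<Rightarrow>\<^sub>0 'k"
    using that by (auto simp: in_keys_iff)
qed simp

lemma keys_bas [simp]: "Poly_Mapping.keys (bas b :: 'b \<Rightarrow>\<^sub>0 'k::field) = {b}"
  by (simp add: bas_def)

lemma keys_lin_ext:
  assumes "\<And>b. b \<in> Poly_Mapping.keys p \<Longrightarrow> Poly_Mapping.keys (\<phi> b) \<subseteq> A"
  shows "Poly_Mapping.keys (lin_ext fscale \<phi> p) \<subseteq> A"
  using lin_ext_in_subspace[OF vector_space_fscale subspace_keys, of p \<phi> A] assms by auto

text \<open>A linear extension that maps the relations into a subspace maps their span into it. This is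
  how maps out of a presented space are seen to be well defined.\<close>

lemma lin_ext_in_span:
  assumes "vector_space sc" "module.subspace sc S" "\<And>r. r \<in> Rel \<Longrightarrow> lin_ext sc \<phi> r \<in> S" "r \<in> fspan Rel"
  shows "lin_ext sc \<phi> r \<in> S"
proof -
  interpret vector_space sc by fact
  interpret h: Vector_Spaces.linear fscale sc "lin_ext sc \<phi>" by (rule lin_ext_linear) fact
  have "fspan Rel \<subseteq> lin_ext sc \<phi> -` S"
    by (rule fs.span_minimal) (use assms h.subspace_vimage in auto)
  with assms(4) show ?thesis by auto
qed

section \<open>Cosets and tensor products\<close>

context module
begin

lemma coset_eq_iff:
  assumes N: "subspace N"
  shows "(p +o N = q +o N) \<longleftrightarrow> p - q \<in> N"
proof
  assume "p +o N = q +o N"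
  moreover have "p \<in> p +o N" using subspace_0[OF N] by (force simp: elt_set_plus_def)
  ultimately show "p - q \<in> N" by (simp add: set_plus_imp_minus)
next
  assume *: "p - q \<in> N"
  have "x - p \<in> N \<longleftrightarrow> x - q \<in> N" for x
    using subspace_add[OF N _ *, of "x - p"] subspace_diff[OF N _ *, of "x - q"] by (auto simp: algebra_simps)
  then show "p +o N = q +o N"
    by (auto simp flip: set_minus_plus)
qed

lemma rep_coset:
  assumes N: "subspace N"
  shows "rep (p +o N) - p \<in> N"
proof -
  have "p \<in> p +o N" using subspace_0[OF N] by (force simp: elt_set_plus_def)
  then have "rep (p +o N) \<in> p +o N" unfolding rep_def by (rule someI)
  then show ?thesis by (rule set_plus_imp_minus)
qed

lemma coset_add:
  assumes N: "subspace N"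
  shows "(p +o N) + (q +o N) = (p + q) +o N"
proof -
  have "N + N \<subseteq> N"
    by (auto elim!: set_plus_elim intro: subspace_add[OF N])
  then have "N + N = N"
    using set_zero_plus2[OF subspace_0[OF N], of N] by blast
  then show ?thesis by (simp add: set_plus_rearrange)
qed

lemma coset_scale:
  assumes N: "subspace N"
  shows "scale c ` (p +o N) + N = scale c p +o N"
proof -
  have "scale c (p + n) + n' \<in> scale c p +o N" if "n \<in> N" "n' \<in> N" for n n'
    using that subspace_add[OF N subspace_scale[OF N, of n c], of n'] by (simp flip: set_minus_plus add: scale_right_distrib)
  moreover have "scale c p + n \<in> scale c ` (p +o N) + N" if "n \<in> N" for n
    using that subspace_0[OF N] by (intro set_plus_intro imageI) (auto simp: elt_set_plus_def intro!: bexI[of _ 0])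
  ultimately show ?thesis
    by (auto simp: set_plus_def elt_set_plus_def)
qed

end

lemmas span_coset_eq_iff = fs.coset_eq_iff[OF fs.subspace_span]
lemmas rep_span_coset = fs.rep_coset[OF fs.subspace_span]

lemma tcls_eq_iff: "tcls V W p = tcls V W q \<longleftrightarrow> p - q \<in> fspan (tensor_rels V W)"
  by (simp add: tcls_def span_coset_eq_iff)

lemma rep_tcls: "rep (tcls V W p) - p \<in> fspan (tensor_rels V W)"
  by (simp add: tcls_def rep_span_coset)

lemma tensor_simps:
  "vcarrier (tensor V W) = tcls V W ` {p. Poly_Mapping.keys p \<subseteq> vcarrier V \<times> vcarrier W}"
  "vadd (tensor V W) (tcls V W p) (tcls V W q) = tcls V W (p + q)"
  "vscale (tensor V W) c (tcls V W p) = tcls V W (fscale c p)"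
  "vzero (tensor V W) = tcls V W 0"
  by (simp_all add: tensor_def presented_def quot_def tcls_def fs.coset_add fs.coset_scale)

lemma subsp_simps [simp]:
  "vcarrier (subsp sc A) = A" "vadd (subsp sc A) = (+)" "vscale (subsp sc A) = sc" "vzero (subsp sc A) = 0"
  by (auto simp: subsp_def)

lemma tcls_rep:
  "X \<in> vcarrier (tensor V W) \<Longrightarrow> tcls V W (rep X) = X"
  unfolding tensor_simps by (elim imageE) (simp add: tcls_eq_iff rep_tcls)

text \<open>Bilinearity on the carriers, modulo a subspace \<open>S\<close> of the target. For vector-valued maps \<open>S\<close>
  is zero; for maps into formal sums it is the span of the tensor relations of the target.\<close>

definition bilin_mod where
  "bilin_mod V W sc S B \<longleftrightarrow>
    (\<forall>v\<in>vcarrier V. \<forall>v'\<in>vcarrier V. \<forall>w\<in>vcarrier W. B (vadd V v v', w) - B (v, w) - B (v', w) \<in> S) \<and>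
    (\<forall>v\<in>vcarrier V. \<forall>w\<in>vcarrier W. \<forall>w'\<in>vcarrier W. B (v, vadd W w w') - B (v, w) - B (v, w') \<in> S) \<and>
    (\<forall>c. \<forall>v\<in>vcarrier V. \<forall>w\<in>vcarrier W. B (vscale V c v, w) - sc c (B (v, w)) \<in> S) \<and>
    (\<forall>c. \<forall>v\<in>vcarrier V. \<forall>w\<in>vcarrier W. B (v, vscale W c w) - sc c (B (v, w)) \<in> S)"

lemma lin_ext_tensor_rels:
  assumes "vector_space sc" "module.subspace sc S" "bilin_mod V W sc S B"
    and "r \<in> fspan (tensor_rels V W)"
  shows "lin_ext sc B r \<in> S"
proof (rule lin_ext_in_span[OF assms(1,2) _ assms(4)])
  fix r assume "r \<in> tensor_rels V W"
  then show "lin_ext sc B r \<in> S"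
    using assms(1,3) unfolding tensor_rels_def bilin_mod_def
    by (auto simp: lin_ext_diff lin_ext_scale)
qed

text \<open>The next two lemmas replace the chosen representative of a class by any representative.\<close>

lemma lin_ext_rep_tcls:
  assumes "vector_space sc" "bilin_mod V W sc {0} B"
  shows "lin_ext sc B (rep (tcls V W p)) = lin_ext sc B p"
proof -
  interpret vector_space sc by fact
  have "lin_ext sc B (rep (tcls V W p) - p) \<in> {0}"
    by (rule lin_ext_tensor_rels[OF assms(1) _ assms(2) rep_tcls]) simp
  then show ?thesis by (simp add: lin_ext_diff[OF assms(1)])
qed

lemma lin_ext_rep_tcls_mod:
  assumes "bilin_mod V W fscale (fspan (tensor_rels V' W')) B"
  shows "tcls V' W' (lin_ext fscale B (rep (tcls V W p))) = tcls V' W' (lin_ext fscale B p)"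
  using lin_ext_tensor_rels[OF vector_space_fscale fs.subspace_span assms rep_tcls, of p]
  by (simp add: tcls_eq_iff lin_ext_diff vector_space_fscale)

lemma tcls_bilinear:
  assumes "v \<in> vcarrier V" "w \<in> vcarrier W"
  shows "v' \<in> vcarrier V \<Longrightarrow> bas (vadd V v v', w) - bas (v, w) - bas (v', w) \<in> fspan (tensor_rels V W)"
    and "w' \<in> vcarrier W \<Longrightarrow> bas (v, vadd W w w') - bas (v, w) - bas (v, w') \<in> fspan (tensor_rels V W)"
    and "bas (vscale V c v, w) - fscale c (bas (v, w)) \<in> fspan (tensor_rels V W)"
    and "bas (v, vscale W c w) - fscale c (bas (v, w)) \<in> fspan (tensor_rels V W)"
  by (rule fs.span_base; use assms in \<open>unfold tensor_rels_def; blast\<close>)+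

lemma pure_bilinear:
  assumes "v \<in> vcarrier V" "w \<in> vcarrier W"
  shows "v' \<in> vcarrier V \<Longrightarrow> pure V W (vadd V v v') w = vadd (tensor V W) (pure V W v w) (pure V W v' w)"
    and "w' \<in> vcarrier W \<Longrightarrow> pure V W v (vadd W w w') = vadd (tensor V W) (pure V W v w) (pure V W v w')"
    and "pure V W (vscale V c v) w = vscale (tensor V W) c (pure V W v w)"
    and "pure V W v (vscale W c w) = vscale (tensor V W) c (pure V W v w)"
  using tcls_bilinear[OF assms]
  by (auto simp: pure_def tensor_simps tcls_eq_iff diff_diff_eq)

lemma pure_in_tensor: "v \<in> vcarrier V \<Longrightarrow> w \<in> vcarrier W \<Longrightarrow> pure V W v w \<in> vcarrier (tensor V W)"
  by (auto simp: pure_def tensor_simps)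

lemma vlinear_tcls_bilin:
  assumes "vlinear V V' f" "vlinear W W' g"
  shows "bilin_mod V W fscale (fspan (tensor_rels V' W')) (\<lambda>(v, w). bas (f v, g w))"
  using assms unfolding bilin_mod_def vlinear_def by (auto intro!: tcls_bilinear)

lemma tmap_tcls:
  assumes "vlinear V V' f" "vlinear W W' g"
  shows "tmap V' W' f g (tcls V W p) = tcls V' W' (lin_ext fscale (\<lambda>(v, w). bas (f v, g w)) p)"
  unfolding tmap_def by (rule lin_ext_rep_tcls_mod[OF vlinear_tcls_bilin[OF assms]])

lemma keys_pair_map:
  assumes "Poly_Mapping.keys p \<subseteq> A \<times> B" "\<And>a. a \<in> A \<Longrightarrow> f a \<in> A'" "\<And>b. b \<in> B \<Longrightarrow> g b \<in> B'"
  shows "Poly_Mapping.keys (lin_ext fscale (\<lambda>(v, w). bas (f v, g w)) p) \<subseteq> A' \<times> B'"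
  by (rule keys_lin_ext) (use assms in auto)

lemma tmap_vlinear:
  assumes "vlinear V V' f" "vlinear W W' g"
  shows "vlinear (tensor V W) (tensor V' W') (tmap V' W' f g)"
  unfolding vlinear_def
proof (intro conjI ballI allI)
  fix X assume "X \<in> vcarrier (tensor V W)"
  then obtain p where p: "X = tcls V W p" "Poly_Mapping.keys p \<subseteq> vcarrier V \<times> vcarrier W"
    by (auto simp: tensor_simps)
  show "tmap V' W' f g X \<in> vcarrier (tensor V' W')"
    unfolding p(1) tmap_tcls[OF assms] tensor_simps
    by (intro imageI CollectI keys_pair_map[OF p(2)]) (use assms in \<open>auto simp: vlinear_def\<close>)
  fix c
  show "tmap V' W' f g (vscale (tensor V W) c X) = vscale (tensor V' W') c (tmap V' W' f g X)"
    by (simp add: p(1) tmap_tcls[OF assms] tensor_simps lin_ext_scale vector_space_fscale)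
  fix Y assume "Y \<in> vcarrier (tensor V W)"
  then obtain q where q: "Y = tcls V W q" "Poly_Mapping.keys q \<subseteq> vcarrier V \<times> vcarrier W"
    by (auto simp: tensor_simps)
  show "tmap V' W' f g (vadd (tensor V W) X Y) = vadd (tensor V' W') (tmap V' W' f g X) (tmap V' W' f g Y)"
    by (simp add: p(1) q(1) tmap_tcls[OF assms] tensor_simps lin_ext_add vector_space_fscale)
qed

text \<open>Additivity and homogeneity, modulo \<open>S\<close>, of a bilinear map evaluated on chosen representatives.\<close>

lemma lin_ext_rep_tensor_mod:
  assumes "module.subspace fscale S" "bilin_mod W U fscale S B"
    and "X \<in> vcarrier (tensor W U)" "Y \<in> vcarrier (tensor W U)"
  shows "lin_ext fscale B (rep (vadd (tensor W U) X Y)) - lin_ext fscale B (rep X) - lin_ext fscale B (rep Y) \<in> S"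
    and "lin_ext fscale B (rep (vscale (tensor W U) c X)) - fscale c (lin_ext fscale B (rep X)) \<in> S"
proof -
  have *: "lin_ext fscale B (rep (tcls W U p)) - lin_ext fscale B p \<in> S" for p
    using lin_ext_tensor_rels[OF vector_space_fscale assms(1,2) rep_tcls, of p]
    by (simp add: lin_ext_diff vector_space_fscale)
  have X: "X = tcls W U (rep X)" and Y: "Y = tcls W U (rep Y)" using assms by (simp_all add: tcls_rep)
  show "lin_ext fscale B (rep (vadd (tensor W U) X Y)) - lin_ext fscale B (rep X) - lin_ext fscale B (rep Y) \<in> S"
    using *[of "rep X + rep Y"] X Y
    by (metis (no_types, lifting) diff_diff_eq lin_ext_add tensor_simps(2) vector_space_fscale)
  show "lin_ext fscale B (rep (vscale (tensor W U) c X)) - fscale c (lin_ext fscale B (rep X)) \<in> S"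
    using *[of "fscale c (rep X)"] X
    by (metis (no_types, lifting) lin_ext_scale tensor_simps(3) vector_space_fscale)
qed

text \<open>Closure of the carrier under the operations. It is the only property of the first factor needed
  to compute the associator on representatives.\<close>

definition vclosed where
  "vclosed V \<longleftrightarrow> (\<forall>x\<in>vcarrier V. \<forall>y\<in>vcarrier V. vadd V x y \<in> vcarrier V) \<and>
     (\<forall>c. \<forall>x\<in>vcarrier V. vscale V c x \<in> vcarrier V)"

lemma tassoc_tcls:
  assumes V: "vclosed V"
  shows
  "tassoc V W U (tcls V (tensor W U) p) =
    tcls (tensor V W) U
      (lin_ext fscale (\<lambda>(v, Y). lin_ext fscale (\<lambda>(w, u). bas (pure V W v w, u)) (rep Y)) p)"
proof -
  let ?S = "fspan (tensor_rels (tensor V W) U)"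
  let ?B = "\<lambda>v (w, u). bas (pure V W v w, u)"
  have bil: "bilin_mod W U fscale ?S (?B v)" if "v \<in> vcarrier V" for v
    unfolding bilin_mod_def
    by (auto simp: pure_bilinear[OF that] intro!: tcls_bilinear pure_in_tensor that)
  (* A representative of Y need not be supported on the carriers, so rep Y is first exchanged
     for a formal sum that is. *)
  have rep: "lin_ext fscale (?B v) (rep (tcls W U p)) - lin_ext fscale (?B v) p \<in> ?S" if "v \<in> vcarrier V" for v p
    using lin_ext_tensor_rels[OF vector_space_fscale fs.subspace_span bil rep_tcls, of v p] that
    by (simp add: lin_ext_diff vector_space_fscale)
  have "bilin_mod V (tensor W U) fscale ?S (\<lambda>(v, Y). lin_ext fscale (?B v) (rep Y))"
    unfolding bilin_mod_def
  proof (intro conjI ballI allI; unfold prod.case)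
    fix v v' Y assume v: "v \<in> vcarrier V" "v' \<in> vcarrier V" and Y: "Y \<in> vcarrier (tensor W U)"
    obtain q where q: "Y = tcls W U q" "Poly_Mapping.keys q \<subseteq> vcarrier W \<times> vcarrier U"
      using Y by (auto simp: tensor_simps)
    have "lin_ext fscale (\<lambda>x. ?B (vadd V v v') x - ?B v x - ?B v' x) q \<in> ?S"
      by (rule lin_ext_in_subspace[OF vector_space_fscale fs.subspace_span])
        (use q in \<open>auto simp: pure_bilinear v intro!: tcls_bilinear pure_in_tensor v\<close>)
    then have *: "lin_ext fscale (?B (vadd V v v')) q - lin_ext fscale (?B v) q - lin_ext fscale (?B v') q \<in> ?S"
      by (simp only: lin_ext_fun_diff[OF vector_space_fscale])
    have "vadd V v v' \<in> vcarrier V" using V v by (auto simp: vclosed_def)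
    from fs.span_diff[OF fs.span_diff[OF fs.span_add[OF rep[OF this, of q] *] rep[OF v(1), of q]] rep[OF v(2), of q]]
    show "lin_ext fscale (?B (vadd V v v')) (rep Y) - lin_ext fscale (?B v) (rep Y) - lin_ext fscale (?B v') (rep Y) \<in> ?S"
      unfolding q(1) by (simp add: algebra_simps)
  next
    fix c v Y assume v: "v \<in> vcarrier V" and Y: "Y \<in> vcarrier (tensor W U)"
    obtain q where q: "Y = tcls W U q" "Poly_Mapping.keys q \<subseteq> vcarrier W \<times> vcarrier U"
      using Y by (auto simp: tensor_simps)
    have "lin_ext fscale (\<lambda>x. ?B (vscale V c v) x - fscale c (?B v x)) q \<in> ?S"
      by (rule lin_ext_in_subspace[OF vector_space_fscale fs.subspace_span])
        (use q in \<open>auto simp: pure_bilinear v intro!: tcls_bilinear pure_in_tensor v\<close>)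
    then have *: "lin_ext fscale (?B (vscale V c v)) q - fscale c (lin_ext fscale (?B v) q) \<in> ?S"
      by (simp only: lin_ext_fun_diff[OF vector_space_fscale] lin_ext_fun_scale[OF vector_space_fscale])
    have "vscale V c v \<in> vcarrier V" using V v by (auto simp: vclosed_def)
    from fs.span_diff[OF fs.span_add[OF rep[OF this, of q] *] fs.span_scale[OF rep[OF v, of q], of c]]
    show "lin_ext fscale (?B (vscale V c v)) (rep Y) - fscale c (lin_ext fscale (?B v) (rep Y)) \<in> ?S"
      unfolding q(1) by (simp add: algebra_simps fs.scale_right_diff_distrib)
  qed (auto simp: lin_ext_rep_tensor_mod[OF fs.subspace_span bil])
  then show ?thesis unfolding tassoc_def by (rule lin_ext_rep_tcls_mod)
qed

section \<open>Separating elements of a tensor product by functionals\<close>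

text \<open>Linear functionals.\<close>

abbreviation linfun where
  "linfun sc \<beta> \<equiv> Vector_Spaces.linear sc (*) \<beta>"

lemma linfunD:
  assumes "linfun sc \<beta>"
  shows "\<beta> (x + y) = \<beta> x + \<beta> y" "\<beta> (x - y) = \<beta> x - \<beta> y" "\<beta> (sc c x) = c * \<beta> x" "\<beta> 0 = 0"
    "\<beta> (sum f A) = (\<Sum>a\<in>A. \<beta> (f a))"
proof -
  interpret Vector_Spaces.linear sc "(*)" \<beta> by fact
  show "\<beta> (x + y) = \<beta> x + \<beta> y" "\<beta> (x - y) = \<beta> x - \<beta> y" "\<beta> (sc c x) = c * \<beta> x" "\<beta> 0 = 0"
    "\<beta> (sum f A) = (\<Sum>a\<in>A. \<beta> (f a))"
    by (rule add diff scale zero sum)+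
qed

lemma linfunI:
  assumes "vector_space sc" "\<And>x y. \<beta> (x + y) = \<beta> x + \<beta> y" "\<And>c x. \<beta> (sc c x) = c * \<beta> x"
  shows "linfun sc \<beta>"
  using assms by (simp add: Vector_Spaces.linear_iff fld.vector_space_axioms)

lemma linfun_diff_scale:
  "linfun sc \<alpha> \<Longrightarrow> linfun sc \<beta> \<Longrightarrow> linfun sc (\<lambda>x. \<alpha> x - c * \<beta> x)"
  by (simp add: Vector_Spaces.linear_iff distrib_left right_diff_distrib mult.left_commute)

text \<open>A map into formal sums that is linear modulo relations commutes with finite linear
  combinations modulo these relations.\<close>

lemma mod_linear_sum:
  assumes "vector_space sc" "module.subspace sc P" "finite A" "\<And>i. i \<in> A \<Longrightarrow> \<phi> i \<in> P"
    and add: "\<And>x y. x \<in> P \<Longrightarrow> y \<in> P \<Longrightarrow> F (x + y) - F x - F y \<in> fspan N"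
    and scale: "\<And>c x. x \<in> P \<Longrightarrow> F (sc c x) - fscale c (F x) \<in> fspan N"
  shows "F (\<Sum>i\<in>A. sc (c i) (\<phi> i)) - (\<Sum>i\<in>A. fscale (c i) (F (\<phi> i))) \<in> fspan N"
  using assms(3,4)
proof (induction rule: finite_induct)
  interpret vector_space sc by fact
  note P = assms(2)
  case empty
  show ?case using add[of 0 0] subspace_0[OF P] fs.span_neg by fastforce
next
  interpret vector_space sc by fact
  note P = assms(2)
  case (insert i A)
  let ?s = "\<Sum>i\<in>A. sc (c i) (\<phi> i)"
  have s: "?s \<in> P" and i: "\<phi> i \<in> P"
    using insert by (auto intro!: subspace_sum[OF P] subspace_scale[OF P])
  from fs.span_add[OF fs.span_add[OF add[OF subspace_scale[OF P i] s] scale[OF i]] insert.IH, of "c i" "c i"] insert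
  show ?case by (simp add: algebra_simps)
qed

lemma whole_vclosed [simp]: "vclosed (whole sc)"
  by (simp add: vclosed_def)

lemma subsp_vclosed: "vector_space sc \<Longrightarrow> module.subspace sc P \<Longrightarrow> vclosed (subsp sc P)"
  by (auto simp: vclosed_def module.subspace_def module_iff_vector_space)

text \<open>An element of \<open>P \<otimes> W\<close> that is killed by \<open>id \<otimes> \<beta>\<close> for every functional \<open>\<beta>\<close> vanishing on a
  subspace \<open>U\<close> lies in the image of \<open>P \<otimes> U\<close>: expand it along a basis of \<open>W\<close> that extends a basis
  of \<open>U\<close>; the coefficients at the basis vectors outside \<open>U\<close> are then zero.\<close>

lemma tensor_separation:
  assumes vM: "vector_space scM" and vW: "vector_space sc"
    and P: "module.subspace scM P" and U: "module.subspace sc U"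
    and p: "Poly_Mapping.keys p \<subseteq> P \<times> UNIV"
    and z: "\<And>\<beta>. linfun sc \<beta> \<Longrightarrow> (\<And>u. u \<in> U \<Longrightarrow> \<beta> u = 0) \<Longrightarrow> lin_ext scM (\<lambda>(a, b). scM (\<beta> b) a) p = 0"
  shows "\<exists>q. Poly_Mapping.keys q \<subseteq> P \<times> U \<and> tcls (subsp scM P) (whole sc) p = tcls (subsp scM P) (whole sc) q"
proof -
  interpret M: vector_space scM by fact
  interpret W: vector_space sc by fact
  let ?N = "tensor_rels (subsp scM P) (whole sc)"
  obtain C where C: "C \<subseteq> U" "W.independent C" "U \<subseteq> W.span C"
    using W.maximal_independent_subset by blast
  define B where "B = W.extend_basis C"
  have B: "W.independent B" "C \<subseteq> B" "W.span B = UNIV"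
    using C(2) by (auto simp: B_def W.independent_extend_basis W.extend_basis_superset W.span_extend_basis)
  define r where "r = W.representation B"
  have rlin: "linfun sc (\<lambda>x. r x b)" for b
    unfolding r_def by (rule W.linear_representation[OF B(1,3)])
  (* The finitely many basis vectors of W that occur in p. *)
  define D where "D = (\<Union>k\<in>Poly_Mapping.keys p. {b. r (snd k) b \<noteq> 0})"
  have D: "finite D" "D \<subseteq> B"
    unfolding D_def r_def by (auto simp: W.finite_representation dest: W.representation_ne_zero)
  have expand: "x = (\<Sum>b\<in>D. sc (r x b) b)" if "(a, x) \<in> Poly_Mapping.keys p" for a x
  proof -
    have "x = (\<Sum>b | r x b \<noteq> 0. sc (r x b) b)"
      unfolding r_def using W.sum_nonzero_representation_eq[OF B(1), of x] B(3) by simp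
    also have "\<dots> = (\<Sum>b\<in>D. sc (r x b) b)"
      by (rule sum.mono_neutral_left[OF D(1)]) (use that in \<open>force simp: D_def\<close>)+
    finally show ?thesis .
  qed
  (* The coefficient in P of the basis vector b. *)
  define v where "v b = lin_ext scM (\<lambda>(a, x). scM (r x b) a) p" for b
  have vP: "v b \<in> P" for b
    unfolding v_def by (rule lin_ext_in_subspace[OF vM P]) (use p M.subspace_scale[OF P] in auto)
  have v0: "v b = 0" if "b \<in> B - C" for b
    unfolding v_def
  proof (rule z[OF rlin])
    fix u assume "u \<in> U"
    then have "W.representation B u = W.representation C u"
      using W.representation_extend[OF B(1) _ B(2), of u] C(3) by auto
    then show "r u b = 0"
      unfolding r_def using that W.representation_ne_zero[of C u b] by auto
  qed
  have right: "bas (a, \<Sum>b\<in>D. sc (r x b) b) - (\<Sum>b\<in>D. fscale (r x b) (bas (a, b))) \<in> fspan ?N"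
    if "a \<in> P" for a x
    by (rule mod_linear_sum[OF vW W.subspace_UNIV D(1)])
      (use that tcls_bilinear[of a "subsp scM P" _ "whole sc"] in auto)
  have left: "bas (v b, b) - lin_ext fscale (\<lambda>(a, x). fscale (r x b) (bas (a, b))) p \<in> fspan ?N" for b
  proof -
    have "bas (\<Sum>k\<in>Poly_Mapping.keys p. scM (Poly_Mapping.lookup p k * r (snd k) b) (fst k), b) -
      (\<Sum>k\<in>Poly_Mapping.keys p. fscale (Poly_Mapping.lookup p k * r (snd k) b) (bas (fst k, b))) \<in> fspan ?N"
      by (rule mod_linear_sum[OF vM P finite_keys, where F = "\<lambda>a. bas (a, b)"])
        (use p tcls_bilinear[of _ "subsp scM P" b "whole sc"] in auto)
    then show ?thesis
      by (simp add: v_def lin_ext_def case_prod_beta)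
  qed
  have "lin_ext fscale (\<lambda>k. bas k - (\<Sum>b\<in>D. fscale (r (snd k) b) (bas (fst k, b)))) p \<in> fspan ?N"
  proof (rule lin_ext_in_subspace[OF vector_space_fscale fs.subspace_span])
    fix k assume k: "k \<in> Poly_Mapping.keys p"
    obtain a x where ax: "k = (a, x)" by (cases k)
    then show "bas k - (\<Sum>b\<in>D. fscale (r (snd k) b) (bas (fst k, b))) \<in> fspan ?N"
      using right[of a x] expand[of a x] k p by auto
  qed
  then have 1: "p - (\<Sum>b\<in>D. lin_ext fscale (\<lambda>k. fscale (r (snd k) b) (bas (fst k, b))) p) \<in> fspan ?N"
    by (simp add: lin_ext_fun_diff lin_ext_fun_sum vector_space_fscale lin_ext_bas_self)
  have 2: "(\<Sum>b\<in>D. bas (v b, b)) - (\<Sum>b\<in>D. lin_ext fscale (\<lambda>k. fscale (r (snd k) b) (bas (fst k, b))) p) \<in> fspan ?N"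
    unfolding sum_subtractf[symmetric] using left by (intro fs.span_sum) (auto simp: case_prod_beta')
  have b0: "bas (0, b) \<in> fspan ?N" for b
    using tcls_bilinear(3)[of 0 "subsp scM P" b "whole sc" 0] M.subspace_0[OF P] by simp
  have 3: "(\<Sum>b\<in>D - C. bas (v b, b)) \<in> fspan ?N"
    using v0 D(2) b0 by (intro fs.span_sum) auto
  let ?q = "\<Sum>b\<in>D \<inter> C. bas (v b, b)"
  have sum: "(\<Sum>b\<in>D. bas (v b, b)) = ?q + (\<Sum>b\<in>D - C. bas (v b, b))"
    by (rule sum.Int_Diff[OF D(1)])
  have "p - ?q = (p - (\<Sum>b\<in>D. bas (v b, b))) + (\<Sum>b\<in>D - C. bas (v b, b))"
    unfolding sum by simp
  moreover have "p - (\<Sum>b\<in>D. bas (v b, b)) \<in> fspan ?N"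
    using fs.span_diff[OF 1 2] by simp
  ultimately have "p - ?q \<in> fspan ?N"
    using fs.span_add[OF _ 3] by (simp only:)
  moreover have "Poly_Mapping.keys ?q \<subseteq> P \<times> U"
    using fs.subspace_sum[OF subspace_keys, of "D \<inter> C" "\<lambda>b. bas (v b, b)" "P \<times> U"] C(1) vP by auto
  ultimately show ?thesis by (auto simp: tcls_eq_iff)
qed

lemma tcls_right_zero:
  assumes "Poly_Mapping.keys q \<subseteq> vcarrier V \<times> {0}" "vector_space sc"
  shows "tcls V (whole sc) q = tcls V (whole sc) 0"
proof -
  interpret vector_space sc by fact
  have "bas (a, 0) \<in> fspan (tensor_rels V (whole sc))" if "a \<in> vcarrier V" for a
    using tcls_bilinear(4)[of a V 0 "whole sc" 0] that by simp
  then have "lin_ext fscale bas q \<in> fspan (tensor_rels V (whole sc))"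
    by (intro lin_ext_in_subspace[OF vector_space_fscale fs.subspace_span]) (use assms in auto)
  then show ?thesis by (simp add: tcls_eq_iff lin_ext_bas_self)
qed

lemma tensor_separation_zero:
  assumes "vector_space scM" and "vector_space sc" and "module.subspace scM P"
    and "Poly_Mapping.keys p \<subseteq> P \<times> UNIV"
    and "\<And>\<beta>. linfun sc \<beta> \<Longrightarrow> lin_ext scM (\<lambda>(a, b). scM (\<beta> b) a) p = 0"
  shows "tcls (subsp scM P) (whole sc) p = tcls (subsp scM P) (whole sc) 0"
proof -
  interpret W: vector_space sc by fact
  from tensor_separation[OF assms(1-3) W.subspace_single_0 assms(4,5)]
  obtain q where q: "Poly_Mapping.keys q \<subseteq> P \<times> {0}"
      "tcls (subsp scM P) (whole sc) p = tcls (subsp scM P) (whole sc) q" by auto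
  then show ?thesis using tcls_right_zero[of q "subsp scM P" sc] assms(2) by simp
qed

lemma linfun_separate:
  assumes "vector_space sc" "module.subspace sc U" "x \<notin> U"
  obtains \<beta> where "linfun sc \<beta>" "\<And>u. u \<in> U \<Longrightarrow> \<beta> u = 0" "\<beta> x = 1"
proof -
  interpret vector_space sc by fact
  interpret vector_space_pair sc "(*)" by unfold_locales
  obtain C where C: "C \<subseteq> U" "independent C" "U \<subseteq> span C"
    using maximal_independent_subset by blast
  have x: "x \<notin> span C" using span_minimal[OF C(1) assms(2)] assms(3) by auto
  then have "independent (insert x C)" using C(2) by (simp add: independent_insert)
  then obtain \<beta> where \<beta>: "linfun sc \<beta>" "\<forall>y\<in>insert x C. \<beta> y = (if y = x then 1 else 0)"
    using linear_independent_extend[of "insert x C" "\<lambda>y. if y = x then 1 else 0"] by blast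
  interpret b: Vector_Spaces.linear sc "(*)" \<beta> by fact
  have "\<beta> y = 0" if "y \<in> C" for y using \<beta>(2) that x span_base by force
  then have "\<beta> u = 0" if "u \<in> U" for u using b.eq_0_on_span[of C u] that C(3) by auto
  with \<beta> show ?thesis by (intro that[of \<beta>]) auto
qed

lemma linfun_eqI:
  assumes "vector_space sc" "\<And>\<beta>. linfun sc \<beta> \<Longrightarrow> \<beta> x = \<beta> y"
  shows "x = y"
proof (rule ccontr)
  interpret vector_space sc by fact
  assume "x \<noteq> y"
  then obtain \<beta> where "linfun sc \<beta>" "\<beta> (x - y) = 1"
    using linfun_separate[OF assms(1) subspace_single_0, of "x - y"] by auto
  then show False using assms(2)[of \<beta>] by (simp add: linfunD)
qed

section \<open>The action of functionals on a comodule\<close>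

text \<open>The contractions \<open>id \<otimes> \<beta>\<close> and \<open>\<alpha> \<otimes> id\<close> on a tensor product, computed on a representing formal
  sum.\<close>

definition contract_right where
  "contract_right scM \<beta> X = lin_ext scM (\<lambda>(a, b). scM (\<beta> b) a) (rep X)"

definition contract_left where
  "contract_left sc \<alpha> X = lin_ext sc (\<lambda>(a, b). sc (\<alpha> a) b) (rep X)"

lemma contract_right_tcls:
  assumes "vector_space scM" "linfun sc \<beta>"
  shows "contract_right scM \<beta> (tcls (subsp scM P) (whole sc) p) = lin_ext scM (\<lambda>(a, b). scM (\<beta> b) a) p"
proof -
  interpret M: vector_space scM by fact
  show ?thesis unfolding contract_right_def
    by (rule lin_ext_rep_tcls[OF assms(1)])
      (simp add: bilin_mod_def linfunD[OF assms(2)] M.scale_right_distrib M.scale_left_distrib mult.commute)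
qed

lemma contract_left_tcls:
  assumes "vector_space sc" "linfun scV \<alpha>"
  shows "contract_left sc \<alpha> (tcls (subsp scV P) (whole sc) p) = lin_ext sc (\<lambda>(a, b). sc (\<alpha> a) b) p"
proof -
  interpret M: vector_space sc by fact
  show ?thesis unfolding contract_left_def
    by (rule lin_ext_rep_tcls[OF assms(1)])
      (simp add: bilin_mod_def linfunD[OF assms(2)] M.scale_right_distrib M.scale_left_distrib mult.commute)
qed

lemma contract_right_vlinear:
  assumes "vector_space scM" "linfun sc \<beta>"
  shows "vlinear (tensor (whole scM) (whole sc)) (whole scM) (contract_right scM \<beta>)"
  by (auto simp: vlinear_def tensor_simps contract_right_tcls[OF assms] lin_ext_add lin_ext_scale assms(1))

lemma contract_left_vlinear:
  assumes "vector_space sc" "linfun scV \<alpha>"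
  shows "vlinear (tensor (whole scV) (whole sc)) (whole sc) (contract_left sc \<alpha>)"
  by (auto simp: vlinear_def tensor_simps contract_left_tcls[OF assms] lin_ext_add lin_ext_scale assms(1))

lemma vlinear_whole:
  assumes "vector_space sc" "vector_space sc'"
  shows "vlinear (whole sc) (whole sc') f \<longleftrightarrow> Vector_Spaces.linear sc sc' f"
  using assms by (auto simp: vlinear_def Vector_Spaces.linear_iff)

lemma vlinear_id [simp]: "vlinear V V id"
  by (simp add: vlinear_def)

lemma vlinear_comp: "vlinear V W f \<Longrightarrow> vlinear W U g \<Longrightarrow> vlinear V U (\<lambda>x. g (f x))"
  by (simp add: vlinear_def)

text \<open>The convolution product \<open>(\<alpha> \<otimes> \<beta>) \<circ> \<Delta>\<close> of functionals on a coalgebra.\<close>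

definition conv where
  "conv \<Delta> \<alpha> \<beta> x = lin_ext (*) (\<lambda>(a, b). \<alpha> a * \<beta> b) (rep (\<Delta> x))"

lemma (in coalgebra) self_comodule: "right_comodule sc \<Delta> \<epsilon> sc \<Delta>"
  by unfold_locales (rule comult_linear coassoc counit_right)+

context right_comodule
begin

text \<open>The left action \<open>\<beta> \<cdot> m = (id \<otimes> \<beta>)(\<psi>(m))\<close> of the functionals on a right comodule.\<close>

definition act where "act \<beta> m = contract_right scM \<beta> (\<psi> m)"

lemma vsM: "vector_space scM" and vsS: "vector_space sc"
  by (rule M.vector_space_axioms \<Sigma>.vector_space_axioms)+

lemma coact_carrier: "\<psi> m \<in> vcarrier (tensor (whole scM) (whole sc))"
  using coact_linear by (auto simp: vlinear_def)

lemma coact_rep: "tcls (whole scM) (whole sc) (rep (\<psi> m)) = \<psi> m"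
  by (rule tcls_rep[OF coact_carrier])

lemma act_linear:
  assumes "linfun sc \<beta>" shows "Vector_Spaces.linear scM scM (act \<beta>)"
  unfolding vlinear_whole[OF vsM vsM, symmetric] act_def[abs_def]
  by (rule vlinear_comp[OF coact_linear contract_right_vlinear[OF vsM assms]])

lemma act_counit: "act \<epsilon> m = m"
  unfolding act_def contract_right_def by (rule coact_counit)

lemma act_fun_add: "act (\<lambda>x. \<alpha> x + \<beta> x) m = act \<alpha> m + act \<beta> m"
  unfolding act_def contract_right_def
  by (simp add: lin_ext_fun_add[OF vsM, symmetric] M.scale_left_distrib case_prod_beta')

lemma act_fun_diff: "act (\<lambda>x. \<alpha> x - \<beta> x) m = act \<alpha> m - act \<beta> m"
  unfolding act_def contract_right_def
  by (simp add: lin_ext_fun_diff[OF vsM, symmetric] M.scale_left_diff_distrib case_prod_beta')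

lemma act_fun_scale: "act (\<lambda>x. c * \<alpha> x) m = scM c (act \<alpha> m)"
  unfolding act_def contract_right_def
  by (simp add: lin_ext_fun_scale[OF vsM, symmetric] case_prod_beta')

lemma act_fun_sum: "act (\<lambda>x. \<Sum>i\<in>A. \<alpha> i x) m = (\<Sum>i\<in>A. act (\<alpha> i) m)"
  unfolding act_def contract_right_def
  by (simp add: lin_ext_fun_sum[OF vsM, symmetric] M.scale_sum_left case_prod_beta')

lemma act_pure:
  assumes "linfun sc \<beta>" "\<psi> m = pure (whole scM) (whole sc) a b"
  shows "act \<beta> m = scM (\<beta> b) a"
  by (simp add: act_def assms(2) pure_def contract_right_tcls[OF vsM assms(1)] vsM)

text \<open>The coaction of an element is determined by the action of the functionals on it.\<close>

lemma coact_separate: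
  assumes "\<And>\<beta>. linfun sc \<beta> \<Longrightarrow> act \<beta> m = lin_ext scM (\<lambda>(a, b). scM (\<beta> b) a) p"
  shows "\<psi> m = tcls (whole scM) (whole sc) p"
proof -
  have "tcls (whole scM) (whole sc) (rep (\<psi> m) - p) = tcls (whole scM) (whole sc) 0"
    by (rule tensor_separation_zero[OF vsM vsS])
      (use assms in \<open>auto simp: lin_ext_diff vsM act_def contract_right_def\<close>)
  then have "tcls (whole scM) (whole sc) (rep (\<psi> m)) = tcls (whole scM) (whole sc) p"
    by (simp add: tcls_eq_iff)
  then show ?thesis by (simp add: coact_rep)
qed

lemma coact_pureI:
  assumes "\<And>\<beta>. linfun sc \<beta> \<Longrightarrow> act \<beta> m = scM (\<beta> b) a"
  shows "\<psi> m = pure (whole scM) (whole sc) a b"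
  unfolding pure_def by (rule coact_separate) (simp add: assms vsM)

lemma conv_linear:
  assumes "linfun sc \<alpha>" "linfun sc \<beta>" shows "linfun sc (conv \<Delta> \<alpha> \<beta>)"
proof -
  have bil: "bilin_mod (whole sc) (whole sc) (*) {0} (\<lambda>(a, b). \<alpha> a * \<beta> b)"
    by (simp add: bilin_mod_def linfunD[OF assms(1)] linfunD(1,3)[OF assms(1)] linfunD(1,3)[OF assms(2)] distrib_left distrib_right)
  have "vlinear (tensor (whole sc) (whole sc)) (whole (*)) (\<lambda>X. lin_ext (*) (\<lambda>(a, b). \<alpha> a * \<beta> b) (rep X))"
    by (auto simp: vlinear_def tensor_simps lin_ext_rep_tcls[OF fld.vector_space_axioms bil]
      lin_ext_add lin_ext_scale fld.vector_space_axioms)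
  from vlinear_comp[OF \<Sigma>.comult_linear this] show ?thesis
    unfolding vlinear_whole[OF vsS fld.vector_space_axioms] conv_def[abs_def] .
qed

text \<open>Coassociativity makes the comodule a module over the algebra of functionals. The two sides of
  the coassociativity axiom are evaluated by \<open>id \<otimes> \<alpha> \<otimes> \<beta>\<close>.\<close>

lemma act_act:
  assumes \<alpha>: "linfun sc \<alpha>" and \<beta>: "linfun sc \<beta>"
  shows "act \<alpha> (act \<beta> m) = act (conv \<Delta> \<alpha> \<beta>) m"
proof -
  let ?p = "rep (\<psi> m)" and ?MS = "tensor (whole scM) (whole sc)" and ?SS = "tensor (whole sc) (whole sc)"
  let ?E = "\<lambda>(Y, u). scM (\<beta> u) (contract_right scM \<alpha> Y)"
  have cl: "vlinear ?MS (whole scM) (contract_right scM \<alpha>)"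
    by (rule contract_right_vlinear[OF vsM \<alpha>])
  have bil: "bilin_mod ?MS (whole sc) scM {0} ?E"
    using cl by (simp add: bilin_mod_def vlinear_def linfunD[OF \<beta>] M.scale_right_distrib M.scale_left_distrib mult.commute)
  note ev = lin_ext_rep_tcls[OF vsM bil]
  have "tmap ?MS (whole sc) \<psi> id (\<psi> m) = tcls ?MS (whole sc) (lin_ext fscale (\<lambda>(a, b). bas (\<psi> a, b)) ?p)"
    using tmap_tcls[OF coact_linear vlinear_id[of "whole sc"], of ?p] by (simp add: coact_rep)
  moreover have "tmap (whole scM) ?SS id \<Delta> (\<psi> m) = tcls (whole scM) ?SS (lin_ext fscale (\<lambda>(a, b). bas (a, \<Delta> b)) ?p)"
    using tmap_tcls[OF vlinear_id[of "whole scM"] \<Sigma>.comult_linear, of ?p] by (simp add: coact_rep)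
  ultimately have "tcls ?MS (whole sc) (lin_ext fscale (\<lambda>(a, b). bas (\<psi> a, b)) ?p) =
     tcls ?MS (whole sc) (lin_ext fscale (\<lambda>(v, Y). lin_ext fscale (\<lambda>(w, u). bas (pure (whole scM) (whole sc) v w, u)) (rep Y))
       (lin_ext fscale (\<lambda>(a, b). bas (a, \<Delta> b)) ?p))"
    using coact_coassoc[of m] by (simp add: tassoc_tcls)
  from arg_cong[OF this, of "\<lambda>Z. lin_ext scM ?E (rep Z)"]
  have "lin_ext scM (\<lambda>(a, b). scM (\<beta> b) (act \<alpha> a)) ?p =
    lin_ext scM (\<lambda>(a, b). lin_ext scM (\<lambda>(w, u). scM (\<beta> u) (scM (\<alpha> w) a)) (rep (\<Delta> b))) ?p"
    unfolding ev
    by (simp add: lin_ext_lin_ext vsM vector_space_fscale case_prod_beta' act_def pure_def contract_right_tcls[OF vsM \<alpha>])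
  moreover have "act \<alpha> (act \<beta> m) = lin_ext scM (\<lambda>(a, b). scM (\<beta> b) (act \<alpha> a)) ?p"
  proof -
    interpret a: Vector_Spaces.linear scM scM "act \<alpha>" by (rule act_linear[OF \<alpha>])
    show ?thesis
      by (subst act_def[of \<beta>], unfold contract_right_def, subst linear_lin_ext[OF a.linear_axioms])
        (simp add: case_prod_beta' a.scale)
  qed
  moreover have "lin_ext scM (\<lambda>(w, u). scM (\<beta> u) (scM (\<alpha> w) a)) q = scM (lin_ext (*) (\<lambda>(w, u). \<alpha> w * \<beta> u) q) a" for a q
    unfolding lin_ext_def M.scale_sum_left by (rule sum.cong) (auto simp: mult.commute)
  ultimately show ?thesis
    by (simp add: act_def[of "conv \<Delta> \<alpha> \<beta>"] contract_right_def conv_def)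
qed

end

section \<open>The dual algebra of a coalgebra\<close>

text \<open>A coalgebra is a right comodule over itself; facts about it as such carry the prefix \<open>S\<close>.\<close>

sublocale coalgebra \<subseteq> S: right_comodule sc \<Delta> \<epsilon> sc \<Delta>
  by (rule self_comodule)

context coalgebra
begin

text \<open>The right action \<open>(\<alpha> \<otimes> id)(\<Delta>(x))\<close> of the functionals on the coalgebra.\<close>

definition lact where "lact \<alpha> x = contract_left sc \<alpha> (\<Delta> x)"

lemma lact_linear:
  assumes "linfun sc \<alpha>" shows "Vector_Spaces.linear sc sc (lact \<alpha>)"
  unfolding vlinear_whole[OF S.vsS S.vsS, symmetric] lact_def[abs_def]
  by (rule vlinear_comp[OF comult_linear contract_left_vlinear[OF S.vsS assms]])

lemma lact_counit: "lact \<epsilon> x = x"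
  unfolding lact_def contract_left_def by (rule counit_left)

lemma conv_act:
  assumes "linfun sc \<alpha>" shows "\<alpha> (S.act \<beta> x) = conv \<Delta> \<alpha> \<beta> x"
  unfolding S.act_def contract_right_def conv_def linear_lin_ext[OF assms]
  by (rule lin_ext_cong) (auto simp: linfunD(3)[OF assms] mult.commute)

lemma conv_lact:
  assumes "linfun sc \<beta>" shows "\<beta> (lact \<alpha> x) = conv \<Delta> \<alpha> \<beta> x"
  unfolding lact_def contract_left_def conv_def linear_lin_ext[OF assms]
  by (rule lin_ext_cong) (auto simp: linfunD(3)[OF assms])

lemma counit_act: "linfun sc \<beta> \<Longrightarrow> \<epsilon> (S.act \<beta> x) = \<beta> x"
  using conv_act[OF counit_linear, of \<beta> x] conv_lact[of \<beta> \<epsilon> x] by (simp add: lact_counit)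

lemma conv_assoc:
  assumes "linfun sc \<alpha>" "linfun sc \<beta>" "linfun sc \<gamma>"
  shows "conv \<Delta> (conv \<Delta> \<alpha> \<beta>) \<gamma> x = conv \<Delta> \<alpha> (conv \<Delta> \<beta> \<gamma>) x"
  using assms
  by (simp add: conv_act[symmetric] S.conv_linear S.act_act del: conv_act)

lemma act_lact:
  assumes "linfun sc \<alpha>" "linfun sc \<beta>"
  shows "S.act \<beta> (lact \<alpha> x) = lact \<alpha> (S.act \<beta> x)"
proof (rule linfun_eqI[OF S.vsS])
  fix \<gamma> assume \<gamma>: "linfun sc \<gamma>"
  have "\<gamma> (S.act \<beta> (lact \<alpha> x)) = conv \<Delta> \<alpha> (conv \<Delta> \<gamma> \<beta>) x"
    by (simp add: conv_act[OF \<gamma>] conv_lact[OF S.conv_linear[OF \<gamma> assms(2)]])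
  also have "\<dots> = \<gamma> (lact \<alpha> (S.act \<beta> x))"
    by (simp add: conv_lact[OF \<gamma>] conv_act[OF S.conv_linear[OF assms(1) \<gamma>]] conv_assoc assms \<gamma>)
  finally show "\<gamma> (S.act \<beta> (lact \<alpha> x)) = \<gamma> (lact \<alpha> (S.act \<beta> x))" .
qed

text \<open>The grouplike elements.\<close>

abbreviation "GL \<equiv> grouplikes sc \<Delta> \<epsilon>"

text \<open>The functionals vanishing on all grouplike elements. They form a two-sided ideal of the dual
  algebra (lemma \<open>perp_conv\<close>).\<close>

definition perp where
  "perp = {\<alpha>. linfun sc \<alpha> \<and> (\<forall>g\<in>GL. \<alpha> g = 0)}"

lemma act_GL: "g \<in> GL \<Longrightarrow> linfun sc \<beta> \<Longrightarrow> S.act \<beta> g = sc (\<beta> g) g"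
  by (rule S.act_pure) (auto simp: grouplikes_def)

lemma lact_GL: "g \<in> GL \<Longrightarrow> linfun sc \<alpha> \<Longrightarrow> lact \<alpha> g = sc (\<alpha> g) g"
  by (simp add: lact_def grouplikes_def pure_def contract_left_tcls S.vsS)

lemma conv_GL: "g \<in> GL \<Longrightarrow> linfun sc \<alpha> \<Longrightarrow> linfun sc \<beta> \<Longrightarrow> conv \<Delta> \<alpha> \<beta> g = \<alpha> g * \<beta> g"
  using conv_act[of \<alpha> \<beta> g] by (simp add: act_GL linfunD mult.commute)

lemma perp_conv:
  "\<alpha> \<in> perp \<Longrightarrow> linfun sc \<beta> \<Longrightarrow> conv \<Delta> \<alpha> \<beta> \<in> perp" "\<alpha> \<in> perp \<Longrightarrow> linfun sc \<beta> \<Longrightarrow> conv \<Delta> \<beta> \<alpha> \<in> perp"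
  by (auto simp: perp_def conv_GL S.conv_linear)

lemma perp_linfun: "\<alpha> \<in> perp \<Longrightarrow> linfun sc \<alpha>" by (simp add: perp_def)

lemma perp_span: "\<alpha> \<in> perp \<Longrightarrow> x \<in> span GL \<Longrightarrow> \<alpha> x = 0"
proof -
  assume a: "\<alpha> \<in> perp" and x: "x \<in> span GL"
  interpret a: Vector_Spaces.linear sc "(*)" \<alpha> using a by (rule perp_linfun)
  show ?thesis using a.eq_0_on_span[of GL x] a x by (simp add: perp_def)
qed

lemma in_span_GL: "(\<And>\<alpha>. \<alpha> \<in> perp \<Longrightarrow> \<alpha> x = 0) \<Longrightarrow> x \<in> span GL"
proof (rule ccontr)
  assume a: "\<And>\<alpha>. \<alpha> \<in> perp \<Longrightarrow> \<alpha> x = 0" and "x \<notin> span GL"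
  then obtain \<beta> where "linfun sc \<beta>" "\<And>u. u \<in> span GL \<Longrightarrow> \<beta> u = 0" "\<beta> x = 1"
    using linfun_separate[OF S.vsS subspace_span] by blast
  then show False using a[of \<beta>] by (auto simp: perp_def span_base)
qed

end

section \<open>The filtration of a comodule by powers of the annihilator of the grouplikes\<close>

context right_comodule
begin

text \<open>The elements killed by all products of \<open>n\<close> functionals from \<open>perp\<close>. On a pointed coalgebra this
  is \<open>F\<^bsub>n-1\<^esub>\<close> of the coradical filtration, so \<open>filt 0\<close> is zero and \<open>filt 1\<close> is the coradical.\<close>

definition filt where
  "filt n = {m. \<forall>\<alpha>s. length \<alpha>s = n \<longrightarrow> set \<alpha>s \<subseteq> \<Sigma>.perp \<longrightarrow> fold act \<alpha>s m = 0}"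

lemma filt_0: "filt 0 = {0}"
  by (auto simp: filt_def)

lemma filt_Suc: "m \<in> filt (Suc n) \<longleftrightarrow> (\<forall>\<alpha>\<in>\<Sigma>.perp. act \<alpha> m \<in> filt n)"
proof
  assume m: "m \<in> filt (Suc n)"
  show "\<forall>\<alpha>\<in>\<Sigma>.perp. act \<alpha> m \<in> filt n"
  proof (clarsimp simp: filt_def)
    fix \<alpha> \<alpha>s assume "\<alpha> \<in> \<Sigma>.perp" "n = length \<alpha>s" "set \<alpha>s \<subseteq> \<Sigma>.perp"
    then show "fold act \<alpha>s (act \<alpha> m) = 0"
      using m[unfolded filt_def, simplified, rule_format, of "\<alpha> # \<alpha>s"] by simp
  qed
next
  assume m: "\<forall>\<alpha>\<in>\<Sigma>.perp. act \<alpha> m \<in> filt n"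
  show "m \<in> filt (Suc n)"
  proof (clarsimp simp: filt_def)
    fix \<alpha>s assume "length \<alpha>s = Suc n" "set \<alpha>s \<subseteq> \<Sigma>.perp"
    then show "fold act \<alpha>s m = 0"
      using m by (cases \<alpha>s) (auto simp: filt_def)
  qed
qed

lemma filt_subspace: "M.subspace (filt n)"
proof (induction n)
  case (Suc n)
  have lin: "Vector_Spaces.linear scM scM (act \<alpha>)" if "\<alpha> \<in> \<Sigma>.perp" for \<alpha>
    by (rule act_linear) (use that in \<open>auto simp: \<Sigma>.perp_def\<close>)
  have "filt (Suc n) = (\<Inter>\<alpha>\<in>\<Sigma>.perp. {m. act \<alpha> m \<in> filt n})"
    by (auto simp: filt_Suc)
  also have "M.subspace \<dots>"
    using Suc module_hom.subspace_linear_preimage[OF lin[unfolded linear_iff_module_hom]] by (intro M.subspace_Int) auto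
  finally show ?case .
qed (simp add: filt_0)

lemma filt_act:
  assumes "linfun sc \<gamma>" "m \<in> filt n" shows "act \<gamma> m \<in> filt n"
proof (cases n)
  case 0
  interpret Vector_Spaces.linear scM scM "act \<gamma>" by (rule act_linear[OF assms(1)])
  show ?thesis using assms(2) 0 by (simp add: filt_0)
next
  case (Suc k)
  then show ?thesis using assms
    by (auto simp: filt_Suc act_act \<Sigma>.perp_linfun \<Sigma>.perp_conv)
qed

lemma filt_mono_Suc: "filt n \<subseteq> filt (Suc n)"
  by (auto simp: filt_Suc \<Sigma>.perp_linfun filt_act)

lemma filt_mono: "n \<le> k \<Longrightarrow> filt n \<subseteq> filt k"
  by (rule lift_Suc_mono_le[of filt, OF filt_mono_Suc])

end

(* Reopening the context makes the new filtration available for the coalgebra itself. *)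
context right_comodule
begin

text \<open>Acting successively by a list of functionals is acting by their convolution product; the head
  of the list acts first, so it is the rightmost factor.\<close>

lemma fold_act:
  assumes "set \<alpha>s \<subseteq> {\<alpha>. linfun sc \<alpha>}"
  shows "\<exists>\<gamma>. linfun sc \<gamma> \<and> (\<forall>m. fold act \<alpha>s m = act \<gamma> m) \<and> (\<forall>x. \<gamma> x = \<epsilon> (fold \<Sigma>.S.act \<alpha>s x))"
  using assms
proof (induction \<alpha>s)
  case Nil
  then show ?case by (intro exI[of _ \<epsilon>]) (simp add: act_counit \<Sigma>.counit_linear)
next
  case (Cons \<alpha> \<alpha>s)
  then obtain \<gamma> where \<gamma>: "linfun sc \<gamma>" "\<forall>m. fold act \<alpha>s m = act \<gamma> m" "\<forall>x. \<gamma> x = \<epsilon> (fold \<Sigma>.S.act \<alpha>s x)"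
    by auto
  have \<alpha>: "linfun sc \<alpha>" using Cons.prems by simp
  show ?case
  proof (intro exI[of _ "conv \<Delta> \<gamma> \<alpha>"] conjI allI)
    show "conv \<Delta> \<gamma> \<alpha> x = \<epsilon> (fold \<Sigma>.S.act (\<alpha> # \<alpha>s) x)" for x
      using \<gamma>(3) by (simp add: \<Sigma>.conv_act[OF \<gamma>(1), symmetric])
  qed (use \<gamma> \<alpha> in \<open>simp_all add: act_act conv_linear\<close>)
qed

text \<open>An element of a comodule lies in the part of the filtration that contains all
  coefficients of its coaction.\<close>

lemma filt_if_coeffs:
  assumes "\<psi> m = tcls (whole scM) (whole sc) p" "snd ` Poly_Mapping.keys p \<subseteq> \<Sigma>.S.filt n"
  shows "m \<in> filt n"
  unfolding filt_def
proof (intro CollectI allI impI)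
  fix \<alpha>s assume \<alpha>s: "length \<alpha>s = n" "set \<alpha>s \<subseteq> \<Sigma>.perp"
  then obtain \<gamma> where \<gamma>: "linfun sc \<gamma>" "\<forall>m. fold act \<alpha>s m = act \<gamma> m" "\<forall>x. \<gamma> x = \<epsilon> (fold \<Sigma>.S.act \<alpha>s x)"
    using fold_act[of \<alpha>s] by (auto simp: \<Sigma>.perp_def)
  have "\<gamma> b = 0" if "(a, b) \<in> Poly_Mapping.keys p" for a b
  proof -
    have "b \<in> \<Sigma>.S.filt n" using assms(2) that by force
    then show ?thesis using \<gamma>(3) \<alpha>s linfunD(4)[OF \<Sigma>.counit_linear] by (simp add: \<Sigma>.S.filt_def)
  qed
  then have "lin_ext scM (\<lambda>(a, b). scM (\<gamma> b) a) p = 0"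
    by (auto simp: lin_ext_def intro!: sum.neutral)
  then show "fold act \<alpha>s m = 0"
    by (simp add: \<gamma>(2) act_def assms(1) contract_right_tcls[OF vsM \<gamma>(1)])
qed

end

context coalgebra
begin

lemma filt_1: "x \<in> S.filt (Suc 0) \<Longrightarrow> x \<in> span GL"
proof (rule in_span_GL)
  fix \<alpha> assume "x \<in> S.filt (Suc 0)" "\<alpha> \<in> perp"
  then have "S.act \<alpha> x = 0" by (simp add: S.filt_Suc S.filt_0)
  then show "\<alpha> x = 0" using counit_act[of \<alpha> x] \<open>\<alpha> \<in> perp\<close> linfunD(4)[OF counit_linear] by (simp add: perp_linfun)
qed

text \<open>For positive index the filtration of the coalgebra is the annihilator of a power of \<open>perp\<close> in the
  dual algebra. Any functional \<open>\<beta>\<close> testing an element of the coalgebra can be absorbed into the functional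
  acting last, because \<open>perp\<close> is an ideal; hence testing with the counit is enough.\<close>

lemma filt_counit:
  "x \<in> S.filt (Suc n) \<longleftrightarrow>
    (\<forall>\<alpha>s. length \<alpha>s = Suc n \<longrightarrow> set \<alpha>s \<subseteq> perp \<longrightarrow> \<epsilon> (fold S.act \<alpha>s x) = 0)"
proof
  assume "x \<in> S.filt (Suc n)"
  then show "\<forall>\<alpha>s. length \<alpha>s = Suc n \<longrightarrow> set \<alpha>s \<subseteq> perp \<longrightarrow> \<epsilon> (fold S.act \<alpha>s x) = 0"
    using linfunD(4)[OF counit_linear] by (simp add: S.filt_def)
next
  assume *: "\<forall>\<alpha>s. length \<alpha>s = Suc n \<longrightarrow> set \<alpha>s \<subseteq> perp \<longrightarrow> \<epsilon> (fold S.act \<alpha>s x) = 0"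
  show "x \<in> S.filt (Suc n)"
    unfolding S.filt_def
  proof (intro CollectI allI impI)
    fix \<alpha>s assume \<alpha>s: "length \<alpha>s = Suc n" "set \<alpha>s \<subseteq> perp"
    then obtain \<beta>s \<alpha> where s: "\<alpha>s = \<beta>s @ [\<alpha>]" by (cases \<alpha>s rule: rev_cases) auto
    show "fold S.act \<alpha>s x = 0"
    proof (rule linfun_eqI[OF S.vsS])
      fix \<beta> assume \<beta>: "linfun sc \<beta>"
      have \<alpha>: "\<alpha> \<in> perp" using \<alpha>s s by simp
      have "\<beta> (fold S.act \<alpha>s x) = conv \<Delta> \<beta> \<alpha> (fold S.act \<beta>s x)"
        by (simp add: s conv_act[OF \<beta>])
      also have "\<dots> = \<epsilon> (fold S.act (\<beta>s @ [conv \<Delta> \<beta> \<alpha>]) x)"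
        by (simp add: counit_act S.conv_linear \<beta> perp_linfun[OF \<alpha>])
      also have "\<dots> = 0"
        using \<alpha>s s perp_conv(2)[OF \<alpha> \<beta>] by (intro *[rule_format]) auto
      finally show "\<beta> (fold S.act \<alpha>s x) = \<beta> 0" using linfunD(4)[OF \<beta>] by simp
    qed
  qed
qed

lemma lact_filt:
  assumes "linfun sc \<gamma>" "x \<in> S.filt n" shows "lact \<gamma> x \<in> S.filt n"
  using assms(2)
proof (induction n arbitrary: x)
  case 0
  interpret Vector_Spaces.linear sc sc "lact \<gamma>" by (rule lact_linear[OF assms(1)])
  show ?case using 0 by (simp add: S.filt_0)
next
  case (Suc n)
  then show ?case by (simp add: S.filt_Suc act_lact assms(1) perp_linfun)
qed

lemma lact_perp_filt:
  assumes "\<alpha> \<in> perp" "x \<in> S.filt (Suc n)" shows "lact \<alpha> x \<in> S.filt n"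
  using assms(2)
proof (induction n arbitrary: x)
  case 0
  have "lact \<alpha> x = 0"
  proof (rule linfun_eqI[OF S.vsS])
    fix \<beta> assume "linfun sc \<beta>"
    then show "\<beta> (lact \<alpha> x) = \<beta> 0"
      using perp_span[OF perp_conv(1)[OF assms(1)] filt_1[OF 0]] by (simp add: conv_lact linfunD)
  qed
  then show ?case by (simp add: S.filt_0)
next
  case (Suc n)
  then show ?case by (simp add: S.filt_Suc[of _ n] S.filt_Suc[of _ "Suc n"] act_lact assms(1) perp_linfun)
qed

text \<open>A functional vanishing on the previous stage of the filtration maps a stage into the span of the
  grouplike elements: the first tensor factors of \<open>\<Delta>(x)\<close> modulo \<open>\<Sigma> \<otimes> filt n\<close> are spanned by
  grouplike elements.\<close>

lemma act_filt_perp: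
  assumes "linfun sc \<beta>" "\<And>u. u \<in> S.filt n \<Longrightarrow> \<beta> u = 0" "x \<in> S.filt (Suc n)"
  shows "S.act \<beta> x \<in> span GL"
proof (rule in_span_GL)
  fix \<alpha> assume \<alpha>: "\<alpha> \<in> perp"
  have "\<alpha> (S.act \<beta> x) = \<beta> (lact \<alpha> x)"
    by (simp add: conv_act conv_lact perp_linfun[OF \<alpha>] assms(1))
  then show "\<alpha> (S.act \<beta> x) = 0" using lact_perp_filt[OF \<alpha> assms(3)] assms(2) by simp
qed

end

section \<open>Coordinates with respect to the grouplike elements\<close>

text \<open>A coalgebra whose grouplike elements are linearly independent.\<close>

locale grouplike_coords = coalgebra +
  assumes independent_GL: "independent GL"
begin

text \<open>The functional reading off the coefficient at \<open>g\<close>, with respect to a fixed basis of the whole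
  coalgebra that extends the grouplike elements.\<close>

definition coord where "coord g x = representation (extend_basis GL) x g"

lemma coord_linfun: "linfun sc (coord g)"
  unfolding coord_def
  by (rule linear_representation) (simp_all add: independent_extend_basis span_extend_basis independent_GL)

lemma coord_GL: "h \<in> GL \<Longrightarrow> coord g h = (if g = h then 1 else 0)"
  unfolding coord_def using extend_basis_superset[OF independent_GL]
  by (subst representation_basis) (auto simp: independent_extend_basis independent_GL)

lemma coord_finite: "finite {g. coord g x \<noteq> 0}"
  by (simp add: coord_def finite_representation)

lemma lact_coord_span:
  assumes "g \<in> GL" "x \<in> span GL" shows "lact (coord g) x = sc (coord g x) g"
proof -
  interpret l: Vector_Spaces.linear sc sc "lact (coord g)" by (rule lact_linear[OF coord_linfun])
  interpret c: Vector_Spaces.linear sc "(*)" "coord g" by (rule coord_linfun)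
  show ?thesis using assms(2)
    by (induction x rule: span_induct_alt)
      (auto simp: l.add l.scale c.add c.scale lact_GL coord_linfun coord_GL scale_left_distrib)
qed

text \<open>On a finite set the counit is a finite sum of coordinates modulo \<open>perp\<close>.\<close>

lemma counit_decomp:
  assumes "finite D"
  obtains A \<gamma> where "finite A" "A \<subseteq> GL" "\<gamma> \<in> perp" "\<And>d. d \<in> D \<Longrightarrow> \<epsilon> d = (\<Sum>g\<in>A. coord g d) + \<gamma> d"
proof -
  interpret vp: vector_space_pair sc "(*)" by unfold_locales
  let ?B = "extend_basis GL"
  have B: "independent ?B" "GL \<subseteq> ?B" "span ?B = UNIV"
    by (simp_all add: independent_extend_basis extend_basis_superset span_extend_basis independent_GL)
  obtain \<gamma> where \<gamma>: "linfun sc \<gamma>" "\<forall>b\<in>?B. \<gamma> b = (if b \<in> GL then 0 else \<epsilon> b)"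
    using vp.linear_independent_extend[OF B(1), of "\<lambda>b. if b \<in> GL then 0 else \<epsilon> b"] by blast
  (* The counit minus \<gamma> is the sum of all coordinates at grouplike elements; only finitely many
     of these are nonzero somewhere on D. *)
  let ?A = "\<Union>d\<in>D. {g\<in>GL. coord g d \<noteq> 0}"
  have A: "finite ?A" using assms coord_finite by (auto intro: finite_subset[rotated])
  show ?thesis
  proof (rule that[OF A _ , of \<gamma>])
    show "\<gamma> \<in> perp" using \<gamma> B(2) by (auto simp: perp_def)
    fix d assume d: "d \<in> D"
    let ?C = "{b. representation ?B d b \<noteq> 0}"
    have C: "finite ?C" "?C \<subseteq> ?B" by (auto simp: finite_representation dest: representation_ne_zero)
    have "d = (\<Sum>b\<in>?C. sc (representation ?B d b) b)"
      using sum_nonzero_representation_eq[OF B(1), of d] B(3) by simp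
    then have "\<epsilon> d - \<gamma> d = \<epsilon> (\<Sum>b\<in>?C. sc (representation ?B d b) b) - \<gamma> (\<Sum>b\<in>?C. sc (representation ?B d b) b)"
      by (rule arg_cong)
    also have "\<dots> = (\<Sum>b\<in>?C. representation ?B d b * (\<epsilon> b - \<gamma> b))"
      unfolding linfunD(5)[OF counit_linear] linfunD(5)[OF \<gamma>(1)] linfunD(3)[OF counit_linear]
        linfunD(3)[OF \<gamma>(1)] right_diff_distrib sum_subtractf ..
    also have "\<dots> = (\<Sum>b\<in>?C \<inter> GL. representation ?B d b * (\<epsilon> b - \<gamma> b))"
      by (rule sum.mono_neutral_right[OF C(1)]) (use \<gamma>(2) subsetD[OF C(2)] in force)+
    also have "\<dots> = (\<Sum>b\<in>?C \<inter> GL. coord b d)"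
      by (rule sum.cong) (use B(2) \<gamma>(2) in \<open>auto simp: coord_def grouplikes_def\<close>)
    also have "\<dots> = (\<Sum>b\<in>?A. coord b d)"
      by (rule sum.mono_neutral_left[OF A]) (use d in \<open>auto simp: coord_def\<close>)
    finally show "\<epsilon> d = (\<Sum>b\<in>?A. coord b d) + \<gamma> d" by (simp add: algebra_simps)
  qed auto
qed

text \<open>Up to a contraction by an element of \<open>perp\<close>, every element is the finite sum of its components
  \<open>x\<^sub>g = lact (coord g) x\<close>.\<close>

lemma lact_decomp:
  obtains A \<gamma> where "finite A" "A \<subseteq> GL" "\<gamma> \<in> perp" "x = (\<Sum>g\<in>A. lact (coord g) x) + lact \<gamma> x"
proof -
  obtain A \<gamma> where A: "finite A" "A \<subseteq> GL" "\<gamma> \<in> perp"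
      "\<And>d. d \<in> fst ` Poly_Mapping.keys (rep (\<Delta> x)) \<Longrightarrow> \<epsilon> d = (\<Sum>g\<in>A. coord g d) + \<gamma> d"
    using counit_decomp[of "fst ` Poly_Mapping.keys (rep (\<Delta> x))"] by auto
  have "x = lin_ext sc (\<lambda>(a, b). sc (\<epsilon> a) b) (rep (\<Delta> x))" by (rule counit_left[symmetric])
  also have "\<dots> = lin_ext sc (\<lambda>k. (\<Sum>g\<in>A. (\<lambda>(a, b). sc (coord g a) b) k) + (\<lambda>(a, b). sc (\<gamma> a) b) k) (rep (\<Delta> x))"
  proof (rule lin_ext_cong)
    fix k assume k: "k \<in> Poly_Mapping.keys (rep (\<Delta> x))"
    obtain a b where ab: "k = (a, b)" by (cases k)
    have "\<epsilon> a = (\<Sum>g\<in>A. coord g a) + \<gamma> a"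
      by (rule A(4)) (use k ab in force)
    then show "(\<lambda>(a, b). sc (\<epsilon> a) b) k = (\<Sum>g\<in>A. (\<lambda>(a, b). sc (coord g a) b) k) + (\<lambda>(a, b). sc (\<gamma> a) b) k"
      by (simp add: ab scale_left_distrib scale_sum_left)
  qed
  also have "\<dots> = (\<Sum>g\<in>A. lact (coord g) x) + lact \<gamma> x"
    unfolding lact_def contract_left_def lin_ext_fun_add[OF S.vsS] lin_ext_fun_sum[OF S.vsS] ..
  finally show ?thesis by (rule that[OF A(1-3)])
qed

text \<open>The component \<open>x\<^sub>g\<close> satisfies \<open>\<Delta>(x\<^sub>g) \<equiv> g \<otimes> x\<^sub>g\<close> modulo \<open>\<Sigma> \<otimes> filt n\<close>, tested by the functionals
  that vanish on \<open>filt n\<close>.\<close>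

lemma act_lact_coord:
  assumes g: "g \<in> GL" and \<beta>: "linfun sc \<beta>" "\<And>u. u \<in> S.filt n \<Longrightarrow> \<beta> u = 0" and x: "x \<in> S.filt (Suc n)"
  shows "S.act \<beta> (lact (coord g) x) = sc (\<beta> (lact (coord g) x)) g"
  using lact_coord_span[OF g act_filt_perp[OF \<beta> x]]
  by (simp add: act_lact coord_linfun \<beta>(1) conv_act[OF coord_linfun] conv_lact[OF \<beta>(1)])

end

section \<open>Tensor powers and products of functionals\<close>

text \<open>The value of \<open>\<alpha>\<^sub>1 \<otimes> \<dots> \<otimes> \<alpha>\<^sub>n\<close> at \<open>v\<^sub>1 \<otimes> \<dots> \<otimes> v\<^sub>n\<close>. The value 0 on lists of a different length makes
  \<open>mult_eval_snoc\<close> hold without side conditions.\<close>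

definition mult_eval :: "('v \<Rightarrow> 'k::field) list \<Rightarrow> 'v list \<Rightarrow> 'k" where
  "mult_eval \<alpha>s l = (if length l = length \<alpha>s then \<Prod>j<length \<alpha>s. (\<alpha>s ! j) (l ! j) else 0)"

lemma mult_eval_snoc: "mult_eval (\<alpha>s @ [\<alpha>]) (l @ [b]) = mult_eval \<alpha>s l * \<alpha> b"
  by (cases "length l = length \<alpha>s") (auto simp: mult_eval_def nth_append intro!: prod.cong)

lemma mult_eval_update:
  assumes "length l = length \<alpha>s" "i < length \<alpha>s"
  shows "mult_eval \<alpha>s (l[i := x]) = (\<alpha>s ! i) x * (\<Prod>j\<in>{..<length \<alpha>s} - {i}. (\<alpha>s ! j) (l ! j))"
  using assms by (auto simp: mult_eval_def prod.remove[of "{..<length \<alpha>s}" i] nth_list_update intro!: prod.cong)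

lemma mult_eval_tpow_rels:
  fixes V :: "('k::field, 'v, 'x) vspace_scheme"
  assumes lin: "\<And>\<alpha> x y. \<alpha> \<in> set \<alpha>s \<Longrightarrow> x \<in> vcarrier V \<Longrightarrow> y \<in> vcarrier V \<Longrightarrow> \<alpha> (vadd V x y) = \<alpha> x + \<alpha> y"
    "\<And>\<alpha> c x. \<alpha> \<in> set \<alpha>s \<Longrightarrow> x \<in> vcarrier V \<Longrightarrow> \<alpha> (vscale V c x) = c * \<alpha> x"
    and n: "length \<alpha>s = n" and r: "r \<in> fspan (tpow_rels n V)"
  shows "lin_ext (*) (mult_eval \<alpha>s) r = 0"
proof -
  have "lin_ext (*) (mult_eval \<alpha>s) r \<in> {0}"
  proof (rule lin_ext_in_span[OF fld.vector_space_axioms fld.subspace_single_0 _ r])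
    fix r assume "r \<in> tpow_rels n V"
    then consider l i x y where "r = bas (l[i := vadd V x y]) - bas (l[i := x]) - bas (l[i := y])"
        "length l = n" "i < n" "x \<in> vcarrier V" "y \<in> vcarrier V"
      | l i c x where "r = bas (l[i := vscale V c x]) - fscale c (bas (l[i := x]))"
        "length l = n" "i < n" "x \<in> vcarrier V"
      unfolding tpow_rels_def by blast
    then show "lin_ext (*) (mult_eval \<alpha>s) r \<in> {0}"
    proof cases
      case (1 l i x y)
      have "(\<alpha>s ! i) (vadd V x y) = (\<alpha>s ! i) x + (\<alpha>s ! i) y"
        by (rule lin) (use 1 n in auto)
      with 1 n show ?thesis
        by (simp add: lin_ext_diff fld.vector_space_axioms mult_eval_update distrib_right)
    next
      case (2 l i c x)
      have "(\<alpha>s ! i) (vscale V c x) = c * (\<alpha>s ! i) x"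
        by (rule lin) (use 2 n in auto)
      with 2 n show ?thesis
        by (simp add: lin_ext_diff lin_ext_scale fld.vector_space_axioms mult_eval_update)
    qed
  qed
  then show ?thesis by simp
qed

lemma rep_tpow_cls: "rep (tpow_cls n V p) - p \<in> fspan (tpow_rels n V)"
  unfolding tpow_cls_def by (rule rep_span_coset)

lemma keys_tpow_rels:
  fixes V :: "('k::field, 'v, 'x) vspace_scheme"
  assumes "r \<in> fspan (tpow_rels n V)" shows "Poly_Mapping.keys r \<subseteq> {l. length l = n}"
proof -
  define K :: "('v list \<Rightarrow>\<^sub>0 'k) set" where "K = {p. Poly_Mapping.keys p \<subseteq> {l. length l = n}}"
  have K: "module.subspace fscale K" unfolding K_def by (rule subspace_keys)
  have "bas l \<in> K" if "length l = n" for l using that by (simp add: K_def)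
  then have "tpow_rels n V \<subseteq> K"
    unfolding tpow_rels_def by (auto intro!: fs.subspace_diff[OF K] fs.subspace_scale[OF K])
  from fs.span_minimal[OF this K] assms show ?thesis by (auto simp: K_def)
qed

context coalgebra
begin

lemma keys_iter_comult: "Poly_Mapping.keys (rep (iter_comult sc \<Delta> k x)) \<subseteq> {l. length l = Suc k}"
proof -
  have *: "Poly_Mapping.keys (rep (tpow_cls n (whole sc) p)) \<subseteq> {l. length l = n}"
    if "Poly_Mapping.keys p \<subseteq> {l. length l = n}" for n p
    using keys_add[of "rep (tpow_cls n (whole sc) p) - p" p] keys_tpow_rels[OF rep_tpow_cls[of n "whole sc" p]] that
    by auto
  show ?thesis
  proof (induction k arbitrary: x)
    case 0
    show ?case using *[of "bas [x]" 1] by simp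
  next
    case (Suc k)
    show ?case unfolding iter_comult.simps
    proof (rule order.trans[OF *])
      show "Poly_Mapping.keys (lin_ext fscale (\<lambda>(a, b). lin_ext fscale (\<lambda>l. bas (l @ [b]))
          (rep (iter_comult sc \<Delta> k a))) (rep (\<Delta> x))) \<subseteq> {l. length l = k + 2}"
      proof (rule keys_lin_ext, unfold split_beta)
        fix z :: "'s \<times> 's"
        show "Poly_Mapping.keys (lin_ext fscale (\<lambda>l. bas (l @ [snd z])) (rep (iter_comult sc \<Delta> k (fst z))))
            \<subseteq> {l. length l = k + 2}"
          by (rule keys_lin_ext) (use Suc[of "fst z"] in auto)
      qed
    qed simp
  qed
qed

text \<open>The iterated coproduct followed by a tensor product of functionals is their convolution product.
  The list is reversed because the last functional acts first.\<close>

lemma mult_eval_iter_comult: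
  assumes "length \<alpha>s = Suc k" "\<And>\<alpha>. \<alpha> \<in> set \<alpha>s \<Longrightarrow> linfun sc \<alpha>"
  shows "lin_ext (*) (mult_eval \<alpha>s) (rep (iter_comult sc \<Delta> k x)) = \<epsilon> (fold S.act (rev \<alpha>s) x)"
proof -
  note vk = fld.vector_space_axioms
  have *: "lin_ext (*) (mult_eval \<alpha>s) (rep (tpow_cls n (whole sc) p)) = lin_ext (*) (mult_eval \<alpha>s) p"
    if "length \<alpha>s = n" "\<And>\<alpha>. \<alpha> \<in> set \<alpha>s \<Longrightarrow> linfun sc \<alpha>" for \<alpha>s n p
  proof -
    have "lin_ext (*) (mult_eval \<alpha>s) (rep (tpow_cls n (whole sc) p) - p) = 0"
      by (rule mult_eval_tpow_rels[OF _ _ that(1) rep_tpow_cls]) (auto dest!: that(2) simp: linfunD(1,3))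
    then show ?thesis by (simp add: lin_ext_diff vk)
  qed
  show ?thesis using assms
  proof (induction k arbitrary: \<alpha>s x)
    case 0
    then obtain \<alpha> where \<alpha>: "\<alpha>s = [\<alpha>]" "linfun sc \<alpha>" by (cases \<alpha>s) auto
    have "mult_eval [\<alpha>] [x] = \<alpha> x" by (simp add: mult_eval_def)
    then show ?case using *[of \<alpha>s 1 "bas [x]"] \<alpha> by (simp add: vk counit_act)
  next
    case (Suc k)
    then obtain \<beta>s \<alpha> where s: "\<alpha>s = \<beta>s @ [\<alpha>]" by (cases \<alpha>s rule: rev_cases) auto
    have \<beta>s: "length \<beta>s = Suc k" "\<And>\<beta>. \<beta> \<in> set \<beta>s \<Longrightarrow> linfun sc \<beta>" and \<alpha>: "linfun sc \<alpha>"
      using Suc.prems s by auto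
    obtain \<gamma> where \<gamma>: "linfun sc \<gamma>" "\<And>x. \<gamma> x = \<epsilon> (fold S.act (rev \<beta>s) x)"
      using S.fold_act[of "rev \<beta>s"] \<beta>s(2) by auto
    have "lin_ext (*) (mult_eval \<alpha>s) (rep (iter_comult sc \<Delta> (Suc k) x)) =
        lin_ext (*) (\<lambda>(a, b). lin_ext (*) (\<lambda>l. \<alpha> b * mult_eval \<beta>s l) (rep (iter_comult sc \<Delta> k a))) (rep (\<Delta> x))"
      unfolding iter_comult.simps
      by (subst *) (use Suc.prems in \<open>auto simp: lin_ext_lin_ext vk vector_space_fscale case_prod_beta' s mult_eval_snoc mult.commute\<close>)
    also have "\<dots> = lin_ext (*) (\<lambda>(a, b). \<gamma> a * \<alpha> b) (rep (\<Delta> x))"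
      by (simp add: lin_ext_fun_scale[OF vk] Suc.IH[OF \<beta>s] \<gamma>(2)[symmetric] mult.commute)
    also have "\<dots> = \<gamma> (S.act \<alpha> x)"
      by (simp add: conv_act[OF \<gamma>(1)] conv_def)
    finally show ?case by (simp add: \<gamma>(2) s)
  qed
qed

text \<open>A product of functionals vanishing on \<open>R\<close>, evaluated on a tensor power of the quotient by \<open>R\<close>.\<close>

lemma mult_eval_quot:
  fixes \<alpha>s :: "('s \<Rightarrow> 'k) list"
  assumes R: "subspace R" and \<alpha>s: "\<forall>\<alpha>\<in>set \<alpha>s. linfun sc \<alpha> \<and> (\<forall>u\<in>R. \<alpha> u = 0)"
  defines "\<beta>s \<equiv> map (\<lambda>\<alpha> X. \<alpha> (rep X)) \<alpha>s"
  shows "lin_ext (*) (mult_eval \<beta>s) (lin_ext fscale (\<lambda>l. bas (map (\<lambda>y. y +o R) l)) p) = lin_ext (*) (mult_eval \<alpha>s) p"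
    and "length \<alpha>s = n \<Longrightarrow> t \<in> fspan (tpow_rels n (quot sc UNIV R)) \<Longrightarrow> lin_ext (*) (mult_eval \<beta>s) t = 0"
proof -
  let ?Q = "quot sc UNIV R" and ?\<pi> = "\<lambda>y. y +o R"
  note vk = fld.vector_space_axioms
  have red: "\<alpha> (rep (?\<pi> x)) = \<alpha> x" if "\<alpha> \<in> set \<alpha>s" for \<alpha> x
    using bspec[OF \<alpha>s that] rep_coset[OF R, of x] linfunD(2)[of sc \<alpha> "rep (?\<pi> x)" x] by auto
  have ev: "mult_eval \<beta>s (map ?\<pi> l) = mult_eval \<alpha>s l" for l
    by (auto simp: mult_eval_def red \<beta>s_def intro!: prod.cong)
  show "lin_ext (*) (mult_eval \<beta>s) (lin_ext fscale (\<lambda>l. bas (map ?\<pi> l)) p) = lin_ext (*) (mult_eval \<alpha>s) p"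
    by (simp add: lin_ext_lin_ext vk ev)
  assume n: "length \<alpha>s = n" and t: "t \<in> fspan (tpow_rels n ?Q)"
  show "lin_ext (*) (mult_eval \<beta>s) t = 0"
  proof (rule mult_eval_tpow_rels[OF _ _ _ t])
    fix \<beta> X Y c assume \<beta>: "\<beta> \<in> set \<beta>s" and X: "X \<in> vcarrier ?Q"
    then obtain \<alpha> x where a: "\<beta> = (\<lambda>X. \<alpha> (rep X))" "\<alpha> \<in> set \<alpha>s" "X = ?\<pi> x" by (auto simp: quot_def \<beta>s_def)
    then have lin: "linfun sc \<alpha>" using \<alpha>s by auto
    have "vscale ?Q c X = ?\<pi> (sc c x)" by (simp add: quot_def a coset_scale[OF R])
    then show "\<beta> (vscale ?Q c X) = c * \<beta> X"
      by (simp add: a red linfunD(3)[OF lin])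
    assume "Y \<in> vcarrier ?Q"
    then obtain y where y: "Y = ?\<pi> y" by (auto simp: quot_def)
    have "vadd ?Q X Y = ?\<pi> (x + y)" by (simp add: quot_def a y coset_add[OF R])
    then show "\<beta> (vadd ?Q X Y) = \<beta> X + \<beta> Y"
      by (simp add: a y red linfunD(1)[OF lin])
  qed (use n in \<open>simp add: \<beta>s_def\<close>)
qed

text \<open>Elements of a tensor power of the quotient by \<open>R\<close> are separated by tensor products of functionals
  vanishing on \<open>R\<close>. A basis \<open>C\<close> of \<open>R\<close> is extended to a basis \<open>B\<close> of the whole space. The tensor power is then
  spanned by the lists with entries from \<open>B - C\<close>, and the coordinate functionals read off the
  coefficients.\<close>

lemma tpow_quot_separation:
  assumes R: "subspace R" and q: "Poly_Mapping.keys q \<subseteq> {l. length l = n}"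
    and z: "\<And>\<alpha>s. length \<alpha>s = n \<Longrightarrow> (\<And>\<alpha>. \<alpha> \<in> set \<alpha>s \<Longrightarrow> linfun sc \<alpha> \<and> (\<forall>u\<in>R. \<alpha> u = 0)) \<Longrightarrow>
      lin_ext (*) (mult_eval \<alpha>s) q = 0"
  shows "lin_ext fscale (\<lambda>l. bas (map (\<lambda>y. y +o R) l)) q \<in> fspan (tpow_rels n (quot sc UNIV R))"
proof -
  let ?Q = "quot sc UNIV R" and ?\<pi> = "\<lambda>y. y +o R"
  let ?rels = "tpow_rels n ?Q"
  have pi_add: "?\<pi> (x + y) = vadd ?Q (?\<pi> x) (?\<pi> y)" and pi_scale: "?\<pi> (sc c x) = vscale ?Q c (?\<pi> x)"
    and pi_car: "?\<pi> x \<in> vcarrier ?Q" for x y c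
    by (auto simp: quot_def coset_add[OF R] coset_scale[OF R])
  obtain C where C: "C \<subseteq> R" "independent C" "R \<subseteq> span C"
    using maximal_independent_subset by blast
  have RC: "R = span C" using C span_minimal[OF C(1) R] by auto
  define B where "B = extend_basis C"
  have B: "independent B" "C \<subseteq> B" "span B = UNIV"
    using C(2) by (auto simp: B_def independent_extend_basis extend_basis_superset span_extend_basis)
  define r where "r b x = representation B x b" for b x
  have rlin: "linfun sc (r b)" for b
    unfolding r_def by (rule linear_representation[OF B(1,3)])
  have r0: "r b u = 0" if "b \<in> B - C" "u \<in> R" for b u
  proof -
    have "representation B u = representation C u"
      by (rule representation_extend[OF B(1) _ B(2)]) (use that C(3) in auto)
    then show ?thesis using that representation_ne_zero[of C u b] by (auto simp: r_def)
  qed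
  let ?L = "{l. length l = n \<and> set l \<subseteq> B - C}"
  let ?F = "lin_ext fscale (\<lambda>l. bas (map ?\<pi> l))"
  let ?X = "fspan (?F ` bas ` ?L \<union> ?rels)"
  have sub: "fspan ?rels \<subseteq> ?X" by (rule fs.span_mono) auto
  (* Induction on the number j of leading entries that are not yet known to be in B - C. *)
  have inX: "bas (map ?\<pi> l) \<in> ?X" if "length l = n" "\<And>i. j \<le> i \<Longrightarrow> i < n \<Longrightarrow> l ! i \<in> B - C" "j \<le> n" for j l
    using that
  proof (induction j arbitrary: l)
    case 0
    then have "l \<in> ?L" by (auto simp: in_set_conv_nth)
    then have "?F (bas l) \<in> ?X" by (intro fs.span_base) auto
    then show ?case by (simp add: vector_space_fscale)
  next
    case (Suc j)
    define G where "G x = (bas (map ?\<pi> (l[j := x])) :: 's set list \<Rightarrow>\<^sub>0 'k)" for x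
    have G: "G x = bas ((map ?\<pi> l)[j := ?\<pi> x])" for x by (simp add: G_def map_update)
    let ?S = "{b. representation B (l ! j) b \<noteq> 0}"
    have S: "finite ?S" "?S \<subseteq> B" by (auto simp: finite_representation dest: representation_ne_zero)
    have lj: "l ! j = (\<Sum>b\<in>?S. sc (r b (l ! j)) b)"
      unfolding r_def using sum_nonzero_representation_eq[OF B(1), of "l ! j"] B(3) by simp
    have "l ! j - (\<Sum>b\<in>?S - C. sc (r b (l ! j)) b) = (\<Sum>b\<in>?S \<inter> C. sc (r b (l ! j)) b)"
      by (subst (1) lj, subst sum.Int_Diff[OF S(1), of _ C]) simp
    also have "\<dots> \<in> R" using C(1) by (intro subspace_sum[OF R] subspace_scale[OF R]) auto
    finally have "G (l ! j) = G (\<Sum>b\<in>?S - C. sc (r b (l ! j)) b)"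
      unfolding G by (simp only: coset_eq_iff[OF R, THEN iffD2])
    moreover have "G (\<Sum>b\<in>?S - C. sc (r b (l ! j)) b) - (\<Sum>b\<in>?S - C. fscale (r b (l ! j)) (G b)) \<in> fspan ?rels"
    proof (rule mod_linear_sum[OF S.vsS subspace_UNIV])
      have l: "length (map ?\<pi> l) = n" "set (map ?\<pi> l) \<subseteq> vcarrier ?Q" "j < n"
        using Suc.prems pi_car by auto
      show "G (x + y) - G x - G y \<in> fspan ?rels" for x y
        unfolding G pi_add tpow_rels_def by (rule fs.span_base) (use l pi_car in blast)
      show "G (sc c x) - fscale c (G x) \<in> fspan ?rels" for c x
        unfolding G pi_scale tpow_rels_def by (rule fs.span_base) (use l pi_car in blast)
    qed (use S in auto)
    moreover have "(\<Sum>b\<in>?S - C. fscale (r b (l ! j)) (G b)) \<in> ?X"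
    proof (intro fs.span_sum fs.span_scale)
      fix b assume b: "b \<in> ?S - C"
      show "G b \<in> ?X" unfolding G_def
      proof (rule Suc.IH)
        show "l[j := b] ! i \<in> B - C" if "j \<le> i" "i < n" for i
          using that Suc.prems b S(2) by (cases "i = j") auto
      qed (use Suc.prems in auto)
    qed
    ultimately have "G (l ! j) \<in> ?X"
      using fs.span_add[of "G (l ! j) - (\<Sum>b\<in>?S - C. fscale (r b (l ! j)) (G b))"] sub by fastforce
    then show ?case by (simp add: G_def)
  qed
  have "?F q \<in> ?X"
    by (rule lin_ext_in_subspace[OF vector_space_fscale fs.subspace_span])
      (rule inX[of _ n], use q in auto)
  then obtain y t where yt: "?F q = y + t" "y \<in> fspan (?F ` bas ` ?L)" "t \<in> fspan ?rels"
    unfolding fs.span_Un by auto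
  interpret F: Vector_Spaces.linear fscale fscale ?F by (rule lin_ext_linear[OF vector_space_fscale])
  have "fspan (bas ` ?L) \<subseteq> {p. Poly_Mapping.keys p \<subseteq> ?L}"
    by (rule fs.span_minimal[OF _ subspace_keys]) auto
  then obtain w where w: "Poly_Mapping.keys w \<subseteq> ?L" "y = ?F w"
    using yt(2) unfolding F.span_image by auto
  have "Poly_Mapping.lookup w l = 0" for l
  proof (cases "l \<in> ?L")
    case True
    note vk = fld.vector_space_axioms
    let ?\<alpha>s = "map r l"
    let ?\<beta>s = "map (\<lambda>\<alpha> X. \<alpha> (rep X)) ?\<alpha>s"
    have perp: "\<forall>\<alpha>\<in>set ?\<alpha>s. linfun sc \<alpha> \<and> (\<forall>u\<in>R. \<alpha> u = 0)"
      using True rlin r0 by auto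
    note ev = mult_eval_quot[OF R perp]
    have "lin_ext (*) (mult_eval ?\<beta>s) t = 0"
      by (rule ev(2)[OF _ yt(3)]) (use True in auto)
    moreover have "lin_ext (*) (mult_eval ?\<beta>s) (?F q) = 0"
      unfolding ev(1) by (rule z) (use True perp in auto)
    ultimately have "lin_ext (*) (mult_eval ?\<alpha>s) w = 0"
      using yt(1) by (simp add: w(2) lin_ext_add[OF vk] ev(1) del: map_map)
    moreover have "lin_ext (*) (mult_eval ?\<alpha>s) w = lin_ext (*) (\<lambda>l'. if l' = l then 1 else 0) w"
    proof (rule lin_ext_cong)
      fix l' assume "l' \<in> Poly_Mapping.keys w"
      then have l': "length l' = n" "set l' \<subseteq> B" using w(1) by auto
      have "mult_eval ?\<alpha>s l' = (\<Prod>j<n. if l' ! j = l ! j then 1 else 0)"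
        using True l' by (auto simp: mult_eval_def r_def representation_basis[OF B(1)] subset_iff intro!: prod.cong)
      also have "\<dots> = (if l' = l then 1 else 0)"
      proof (cases "l' = l")
        case False
        then obtain j where "j < n" "l' ! j \<noteq> l ! j"
          using True l' by (auto simp: list_eq_iff_nth_eq)
        then show ?thesis using False by (auto intro!: prod_zero)
      qed simp
      finally show "mult_eval ?\<alpha>s l' = (if l' = l then 1 else 0)" .
    qed
    moreover have "lin_ext (*) (\<lambda>l'. if l' = l then 1 else 0) w = Poly_Mapping.lookup w l"
      by (simp add: lin_ext_def if_distrib not_in_keys_iff_lookup_eq_zero cong: if_cong)
    ultimately show ?thesis by simp
  qed (use w(1) in \<open>auto simp: in_keys_iff\<close>)
  then have "w = 0" by (intro poly_mapping_eqI) simp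
  then show ?thesis using yt w by simp
qed

section \<open>The coradical filtration of a pointed coalgebra\<close>

lemma GL_nonzero: "g \<in> GL \<Longrightarrow> g \<noteq> 0"
  using linfunD(4)[OF counit_linear] by (auto simp: grouplikes_def)

lemma simple_subcoalgebra_GL:
  assumes g: "g \<in> GL" shows "simple_subcoalgebra sc \<Delta> (span {g})"
  unfolding simple_subcoalgebra_def
proof (intro conjI allI impI)
  have "\<Delta> (sc c g) \<in> tensor_image (whole sc) (whole sc) (span {g}) (span {g})" for c
  proof -
    have "\<Delta> (sc c g) = vscale (tensor (whole sc) (whole sc)) c (\<Delta> g)"
      using comult_linear by (simp add: vlinear_def)
    also have "\<dots> = tcls (whole sc) (whole sc) (fscale c (bas (g, g)))"
      using g by (simp add: grouplikes_def pure_def tensor_simps)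
    finally show ?thesis
      unfolding tensor_image_def by (rule image_eqI) (auto simp: in_keys_iff bas_def lookup_single when_def span_base split: if_splits)
  qed
  then show "subcoalgebra sc \<Delta> (span {g})"
    unfolding subcoalgebra_def using span_singleton[of g] subspace_span[of "{g}"] by auto
  show "span {g} \<noteq> {0}" using GL_nonzero[OF g] span_base[of g "{g}"] by auto
  fix D assume D: "subcoalgebra sc \<Delta> D \<and> D \<subseteq> span {g}"
  then have sub: "subspace D" by (simp add: subcoalgebra_def)
  show "D = {0} \<or> D = span {g}"
  proof (cases "D \<subseteq> {0}")
    case True
    then show ?thesis using subspace_0[OF sub] by auto
  next
    case False
    then obtain d where d: "d \<in> D" "d \<noteq> 0" by auto
    then obtain c where c: "d = sc c g" "c \<noteq> 0" using D by (auto simp: span_singleton)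
    then have "g = sc (inverse c) d" by simp
    then have "g \<in> D" using subspace_scale[OF sub d(1)] by metis
    then show ?thesis using D span_minimal[OF _ sub, of "{g}"] by auto
  qed
qed

text \<open>A one-dimensional subcoalgebra is spanned by a grouplike element, the rescaling of a generator
  to counit 1.\<close>

lemma simple_subcoalgebra_pointed:
  assumes "pointed sc \<Delta>" "simple_subcoalgebra sc \<Delta> C"
  shows "C \<subseteq> span GL"
proof -
  have C: "subspace C" "\<Delta> ` C \<subseteq> tensor_image (whole sc) (whole sc) C C" "dim C = 1"
    using assms by (auto simp: simple_subcoalgebra_def subcoalgebra_def pointed_def)
  obtain B where B: "B \<subseteq> C" "independent B" "C \<subseteq> span B" "card B = dim C"
    using basis_exists by blast
  then obtain x where x: "B = {x}" using C(3) by (auto simp: card_1_singleton_iff)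
  have x0: "x \<noteq> 0" using B(2) x dependent_zero by auto
  have Cx: "C = span {x}" using B x span_minimal[OF B(1) C(1)] by auto
  have act: "\<exists>t. S.act \<beta> x = sc t x" if \<beta>: "linfun sc \<beta>" for \<beta>
  proof -
    obtain p where p: "\<Delta> x = tcls (whole sc) (whole sc) p" "Poly_Mapping.keys p \<subseteq> C \<times> C"
      using C(2) B(1) x by (auto simp: tensor_image_def)
    have "S.act \<beta> x = lin_ext sc (\<lambda>(a, b). sc (\<beta> b) a) p"
      by (simp add: S.act_def p(1) contract_right_tcls[OF S.vsS \<beta>])
    also have "\<dots> \<in> C"
      by (rule lin_ext_in_subspace[OF S.vsS C(1)]) (use p(2) subspace_scale[OF C(1)] in auto)
    finally show ?thesis by (auto simp: Cx span_singleton)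
  qed
  have act': "sc (\<epsilon> x) (S.act \<beta> x) = sc (\<beta> x) x" if \<beta>: "linfun sc \<beta>" for \<beta>
    using act[OF \<beta>] counit_act[OF \<beta>, of x] linfunD(3)[OF counit_linear]
    by (auto simp: mult.commute)
  have "\<epsilon> x \<noteq> 0"
  proof
    assume "\<epsilon> x = 0"
    then have "\<beta> x = \<beta> 0" if "linfun sc \<beta>" for \<beta>
      using act'[OF that] x0 linfunD(4)[OF that] by simp
    then show False using linfun_eqI[OF S.vsS, of x 0] x0 by blast
  qed
  define g where "g = sc (inverse (\<epsilon> x)) x"
  have gx: "x = sc (\<epsilon> x) g" using \<open>\<epsilon> x \<noteq> 0\<close> by (simp add: g_def)
  have "\<Delta> g = pure (whole sc) (whole sc) g g"
  proof (rule S.coact_pureI)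
    fix \<beta> assume \<beta>: "linfun sc \<beta>"
    interpret a: Vector_Spaces.linear sc sc "S.act \<beta>" by (rule S.act_linear[OF \<beta>])
    have "S.act \<beta> g = sc (inverse (\<epsilon> x) * inverse (\<epsilon> x)) (sc (\<epsilon> x) (S.act \<beta> x))"
      unfolding g_def a.scale scale_scale using \<open>\<epsilon> x \<noteq> 0\<close> by (simp add: mult.assoc)
    also have "\<dots> = sc (inverse (\<epsilon> x) * inverse (\<epsilon> x)) (sc (\<beta> x) x)"
      by (simp only: act'[OF \<beta>])
    also have "\<dots> = sc (\<beta> g) g"
      by (simp only: g_def linfunD(3)[OF \<beta>] scale_scale mult_ac)
    finally show "S.act \<beta> g = sc (\<beta> g) g" .
  qed
  moreover have "\<epsilon> g = 1" using \<open>\<epsilon> x \<noteq> 0\<close> linfunD(3)[OF counit_linear] by (simp add: g_def)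
  ultimately have "g \<in> GL" by (simp add: grouplikes_def)
  then have "x \<in> span GL" by (subst gx) (intro span_scale span_base)
  then show ?thesis unfolding Cx by (intro span_minimal) auto
qed

lemma coradical_pointed:
  assumes "pointed sc \<Delta>" shows "coradical sc \<Delta> = span GL"
proof
  show "coradical sc \<Delta> \<subseteq> span GL"
    unfolding coradical_def using simple_subcoalgebra_pointed[OF assms] by (intro span_minimal) auto
  show "span GL \<subseteq> coradical sc \<Delta>"
    unfolding coradical_def
  proof (rule span_mono, rule subsetI)
    fix g assume "g \<in> GL"
    then show "g \<in> \<Union> {C. simple_subcoalgebra sc \<Delta> C}"
      by (intro UnionI[of "span {g}"] CollectI simple_subcoalgebra_GL span_base) simp_all
  qed
qed

lemma corad_filt_pointed:
  assumes "pointed sc \<Delta>" shows "corad_filt sc \<Delta> k = S.filt (Suc k)"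
proof -
  let ?R = "span GL"
  let ?Q = "quot sc UNIV ?R" and ?q = "\<lambda>x. rep (iter_comult sc \<Delta> k x)"
  let ?F = "lin_ext fscale (\<lambda>l. bas (map (\<lambda>y. y +o ?R) l))"
  have perp: "\<alpha> \<in> perp \<longleftrightarrow> linfun sc \<alpha> \<and> (\<forall>u\<in>?R. \<alpha> u = 0)" for \<alpha>
    using perp_span span_base by (auto simp: perp_def)
  have "x \<in> corad_filt sc \<Delta> k \<longleftrightarrow> ?F (?q x) \<in> fspan (tpow_rels (Suc k) ?Q)" for x
  proof -
    have "x \<in> corad_filt sc \<Delta> k \<longleftrightarrow>
        ?F (?q x) +o fspan (tpow_rels (Suc k) ?Q) = 0 +o fspan (tpow_rels (Suc k) ?Q)"
      by (simp add: corad_filt_def coradical_pointed[OF assms] tpow_map_def tpow_cls_def tpow_def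
          presented_def quot_def Let_def)
    then show ?thesis by (simp only: span_coset_eq_iff diff_zero)
  qed
  also have "\<dots> x \<longleftrightarrow> (\<forall>\<alpha>s. length \<alpha>s = Suc k \<longrightarrow> set \<alpha>s \<subseteq> perp \<longrightarrow> lin_ext (*) (mult_eval \<alpha>s) (?q x) = 0)" for x
  proof (intro iffI allI impI)
    fix \<alpha>s assume F: "?F (?q x) \<in> fspan (tpow_rels (Suc k) ?Q)" and \<alpha>s: "length \<alpha>s = Suc k" "set \<alpha>s \<subseteq> perp"
    have "\<forall>\<alpha>\<in>set \<alpha>s. linfun sc \<alpha> \<and> (\<forall>u\<in>?R. \<alpha> u = 0)" using \<alpha>s(2) perp by auto
    note ev = mult_eval_quot[OF subspace_span this]
    show "lin_ext (*) (mult_eval \<alpha>s) (?q x) = 0"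
      using ev(2)[OF \<alpha>s(1) F] ev(1)[of "?q x"] by simp
  next
    assume z: "\<forall>\<alpha>s. length \<alpha>s = Suc k \<longrightarrow> set \<alpha>s \<subseteq> perp \<longrightarrow> lin_ext (*) (mult_eval \<alpha>s) (?q x) = 0"
    show "?F (?q x) \<in> fspan (tpow_rels (Suc k) ?Q)"
      by (rule tpow_quot_separation[OF subspace_span keys_iter_comult]) (use z perp in \<open>auto simp: subset_iff\<close>)
  qed
  also have "\<dots> x \<longleftrightarrow> (\<forall>\<alpha>s. length \<alpha>s = Suc k \<longrightarrow> set \<alpha>s \<subseteq> perp \<longrightarrow> \<epsilon> (fold S.act (rev \<alpha>s) x) = 0)" for x
    using mult_eval_iter_comult[of _ k x] by (auto simp: perp_linfun subset_iff)
  also have "\<dots> x \<longleftrightarrow> x \<in> S.filt (Suc k)" for x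
    unfolding filt_counit by (metis length_rev rev_rev_ident set_rev)
  finally show ?thesis by blast
qed

lemma corad_filt_pred_pointed:
  assumes "pointed sc \<Delta>" shows "corad_filt_pred sc \<Delta> k = S.filt k"
  by (cases k) (simp_all add: corad_filt_pred_def corad_filt_pointed[OF assms] S.filt_0)

end

section \<open>Products in tensor products of algebras\<close>

lemma linear_scale_mult:
  assumes "unital_algebra sc" shows "Vector_Spaces.linear sc sc ((*) a)"
proof -
  interpret unital_algebra sc by fact
  show ?thesis by (simp add: Vector_Spaces.linear_iff vector_space_axioms distrib_left scale_mult_right)
qed

text \<open>The product can be computed on arbitrary representatives.\<close>

lemma tmult_tcls:
  fixes scA :: "'k::field \<Rightarrow> 'a::ring_1 \<Rightarrow> 'a" and scB :: "'k \<Rightarrow> 'b::ring_1 \<Rightarrow> 'b"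
  assumes A: "unital_algebra scA" and B: "unital_algebra scB"
  shows "tmult scA scB (tcls (whole scA) (whole scB) p) (tcls (whole scA) (whole scB) q) =
    tcls (whole scA) (whole scB)
      (lin_ext fscale (\<lambda>(a, b). lin_ext fscale (\<lambda>(c, d). bas (a * c, b * d)) q) p)"
proof -
  interpret A: unital_algebra scA by fact
  interpret B: unital_algebra scB by fact
  let ?t = "tcls (whole scA) (whole scB)" and ?N = "fspan (tensor_rels (whole scA) (whole scB))"
  let ?f = "\<lambda>a b (c, d). bas (a * c, b * d)"
  let ?r = "rep (?t q)"
  have bil2: "bilin_mod (whole scA) (whole scB) fscale ?N (?f a b)" for a b
    unfolding bilin_mod_def
    using tcls_bilinear[of _ "whole scA" _ "whole scB"]
    by (simp add: distrib_left A.scale_mult_right B.scale_mult_right)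
  have fun_diff: "lin_ext fscale \<phi> r - lin_ext fscale \<theta> r - lin_ext fscale \<xi> r \<in> ?N"
    if "\<And>k. \<phi> k - \<theta> k - \<xi> k \<in> ?N" for \<phi> \<theta> \<xi> :: "'a \<times> 'b \<Rightarrow> _" and r
    by (simp add: lin_ext_fun_diff[OF vector_space_fscale, symmetric] lin_ext_in_subspace vector_space_fscale that)
  have fun_scale: "lin_ext fscale \<phi> r - fscale c (lin_ext fscale \<theta> r) \<in> ?N"
    if "\<And>k. \<phi> k - fscale c (\<theta> k) \<in> ?N" for \<phi> \<theta> :: "'a \<times> 'b \<Rightarrow> _" and r c
    by (simp add: lin_ext_fun_diff[OF vector_space_fscale, symmetric] lin_ext_fun_scale[OF vector_space_fscale, symmetric]
        lin_ext_in_subspace vector_space_fscale that)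
  have bil1: "bilin_mod (whole scA) (whole scB) fscale ?N (\<lambda>(a, b). lin_ext fscale (?f a b) ?r)"
    unfolding bilin_mod_def prod.case
    by (intro conjI ballI allI fun_diff fun_scale)
      (use tcls_bilinear[of _ "whole scA" _ "whole scB"] in
        \<open>simp_all add: case_prod_beta' distrib_right A.scale_mult_left B.scale_mult_left\<close>)
  have "lin_ext fscale (\<lambda>(a, b). lin_ext fscale (?f a b) ?r) p - lin_ext fscale (\<lambda>(a, b). lin_ext fscale (?f a b) q) p
      = lin_ext fscale (\<lambda>(a, b). lin_ext fscale (?f a b) (?r - q)) p"
    by (simp add: lin_ext_fun_diff[OF vector_space_fscale, symmetric] lin_ext_diff vector_space_fscale case_prod_beta')
  also have "\<dots> \<in> ?N"
    by (rule lin_ext_in_subspace[OF vector_space_fscale fs.subspace_span])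
      (auto intro!: lin_ext_tensor_rels[OF vector_space_fscale fs.subspace_span bil2] rep_tcls)
  finally have "?t (lin_ext fscale (\<lambda>(a, b). lin_ext fscale (?f a b) ?r) p) =
      ?t (lin_ext fscale (\<lambda>(a, b). lin_ext fscale (?f a b) q) p)"
    by (simp add: tcls_eq_iff)
  then show ?thesis
    unfolding tmult_def lin_ext_rep_tcls_mod[OF bil1] .
qed

lemma tmult_pure:
  assumes "unital_algebra scA" "unital_algebra scB"
  shows "tmult scA scB (pure (whole scA) (whole scB) a b) (tcls (whole scA) (whole scB) q) =
    tcls (whole scA) (whole scB) (lin_ext fscale (\<lambda>(c, d). bas (a * c, b * d)) q)"
  by (simp add: pure_def tmult_tcls[OF assms] vector_space_fscale)

lemma tmult_pure_pure:
  assumes "unital_algebra scA" "unital_algebra scB"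
  shows "tmult scA scB (pure (whole scA) (whole scB) a b) (pure (whole scA) (whole scB) c d) =
    pure (whole scA) (whole scB) (a * c) (b * d)"
  using tmult_pure[OF assms, of a b "bas (c, d)"] by (simp add: pure_def vector_space_fscale)

text \<open>The identity \<open>(id \<otimes> \<beta>)((a \<otimes> b) X) = a (id \<otimes> \<beta>(b -))(X)\<close>.\<close>

lemma contract_right_tmult:
  assumes A: "unital_algebra scA" and B: "unital_algebra scB" and \<beta>: "linfun scB \<beta>"
    and X: "X \<in> vcarrier (tensor (whole scA) (whole scB))"
  shows "contract_right scA \<beta> (tmult scA scB (pure (whole scA) (whole scB) a b) X) =
    a * contract_right scA (\<lambda>y. \<beta> (b * y)) X"
proof -
  interpret A: unital_algebra scA by fact
  have vs: "vector_space scA" by unfold_locales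
  have X': "tcls (whole scA) (whole scB) (rep X) = X" using X by (rule tcls_rep)
  have "contract_right scA \<beta> (tmult scA scB (pure (whole scA) (whole scB) a b) X) =
      lin_ext scA (\<lambda>(c, d). scA (\<beta> (b * d)) (a * c)) (rep X)"
    using tmult_pure[OF A B, of a b "rep X"]
    by (simp add: X' contract_right_tcls[OF vs \<beta>] lin_ext_lin_ext vs case_prod_beta')
  also have "\<dots> = a * contract_right scA (\<lambda>y. \<beta> (b * y)) X"
    unfolding contract_right_def linear_lin_ext[OF linear_scale_mult[OF A]]
    by (rule lin_ext_cong) (auto simp: A.scale_mult_right)
  finally show ?thesis .
qed

lemma linfun_translate:
  assumes "unital_algebra sc" "linfun sc \<beta>" shows "linfun sc (\<lambda>y. \<beta> (g * y))"
proof -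
  interpret unital_algebra sc by fact
  show ?thesis
    by (rule linfunI) (simp_all add: vector_space_axioms distrib_left scale_mult_right linfunD[OF assms(2)])
qed

section \<open>Translation by grouplike elements\<close>

context bialgebra
begin

lemma ualg: "unital_algebra sc" by unfold_locales

lemma GL_mult: "g \<in> GL \<Longrightarrow> h \<in> GL \<Longrightarrow> g * h \<in> GL"
  by (simp add: grouplikes_def comult_mult counit_mult tmult_pure_pure[OF ualg ualg])

lemma perp_translate: "\<alpha> \<in> perp \<Longrightarrow> g \<in> GL \<Longrightarrow> (\<lambda>y. \<alpha> (g * y)) \<in> perp"
  by (auto simp: perp_def GL_mult linfun_translate[OF ualg])

lemma act_translate:
  "g \<in> GL \<Longrightarrow> linfun sc \<beta> \<Longrightarrow> S.act \<beta> (g * x) = g * S.act (\<lambda>y. \<beta> (g * y)) x"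
  using contract_right_tmult[OF ualg ualg _ S.coact_carrier, of \<beta> g g x]
  by (simp add: S.act_def comult_mult grouplikes_def)

lemma filt_translate:
  assumes "g \<in> GL" shows "x \<in> S.filt n \<Longrightarrow> g * x \<in> S.filt n"
proof (induction n arbitrary: x)
  case (Suc n)
  then show ?case
    by (simp add: S.filt_Suc act_translate assms perp_linfun perp_translate)
qed (simp add: S.filt_0)

end

text \<open>The component \<open>x\<^sub>g\<close> of an element of the filtration becomes a graded left primitive when it is
  multiplied by \<open>g\<^sup>-\<^sup>1\<close>.\<close>

lemma graded_left_primitive_component:
  fixes sc :: "'k::field \<Rightarrow> 's::ring_1 \<Rightarrow> 's"
  assumes "bialgebra sc \<Delta> \<epsilon>" "grouplike_coords sc \<Delta> \<epsilon>" and pt: "pointed sc \<Delta>"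
    and g: "g \<in> grouplikes sc \<Delta> \<epsilon>" "g' \<in> grouplikes sc \<Delta> \<epsilon>" "g' * g = 1"
    and x: "x \<in> right_comodule.filt sc \<Delta> \<epsilon> sc \<Delta> (Suc n)"
  shows "g' * coalgebra.lact sc \<Delta> (grouplike_coords.coord sc \<Delta> \<epsilon> g) x \<in> graded_left_primitives sc \<Delta> sc \<Delta> 1 n"
proof -
  interpret bialgebra sc \<Delta> \<epsilon> by fact
  interpret C: grouplike_coords sc \<Delta> \<epsilon> by fact
  let ?x = "lact (C.coord g) x"
  let ?b = "g' * ?x"
  have bf: "?b \<in> S.filt (Suc n)"
    by (intro filt_translate lact_filt C.coord_linfun g x)
  have zero: "lin_ext sc (\<lambda>(a, b). sc (\<beta> b) a) (rep (\<Delta> ?b) - bas (1, ?b)) = 0"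
    if \<beta>: "linfun sc \<beta>" "\<And>u. u \<in> S.filt n \<Longrightarrow> \<beta> u = 0" for \<beta>
  proof -
    have "S.act \<beta> ?b = g' * S.act (\<lambda>y. \<beta> (g' * y)) ?x"
      by (rule act_translate[OF g(2) \<beta>(1)])
    also have "S.act (\<lambda>y. \<beta> (g' * y)) ?x = sc (\<beta> ?b) g"
      by (rule C.act_lact_coord[OF g(1) linfun_translate[OF ualg \<beta>(1)] _ x]) (simp add: \<beta>(2) filt_translate g(2))
    also have "g' * sc (\<beta> ?b) g = sc (\<beta> ?b) 1"
      by (simp add: scale_mult_right g(3))
    finally show ?thesis
      by (simp add: lin_ext_diff S.vsS S.act_def contract_right_def)
  qed
  have "\<exists>q. Poly_Mapping.keys q \<subseteq> UNIV \<times> S.filt n \<and>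
      tcls (whole sc) (whole sc) (rep (\<Delta> ?b) - bas (1, ?b)) = tcls (whole sc) (whole sc) q"
    by (rule tensor_separation[OF S.vsS S.vsS subspace_UNIV S.filt_subspace _ zero]) simp_all
  then obtain q where q: "Poly_Mapping.keys q \<subseteq> UNIV \<times> S.filt n"
    "tcls (whole sc) (whole sc) (rep (\<Delta> ?b) - bas (1, ?b)) = tcls (whole sc) (whole sc) q" by blast
  have "\<Delta> ?b = tcls (whole sc) (whole sc) (rep (\<Delta> ?b))"
    by (rule S.coact_rep[symmetric])
  also have "\<dots> = tcls (whole sc) (whole sc) (bas (1, ?b) + q)"
    using q(2) by (simp add: tcls_eq_iff diff_diff_eq)
  also have "\<dots> = vadd (tensor (whole sc) (whole sc)) (pure (whole sc) (whole sc) 1 ?b) (tcls (whole sc) (whole sc) q)"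
    by (simp add: pure_def tensor_simps)
  finally show ?thesis
    unfolding graded_left_primitives_def corad_filt_pointed[OF pt] corad_filt_pred_pointed[OF pt] tensor_image_def
    using q(1) by (intro CollectI bexI[OF _ bf] bexI[OF _ imageI[of q]])
qed

section \<open>Comodule maps into a cofree comodule\<close>

text \<open>A linear map \<open>\<phi>\<close> into \<open>P\<close> induces a comodule map \<open>(\<phi> \<otimes> id) \<circ> \<psi>\<close> into the cofree comodule on \<open>P\<close>:
  apply \<open>\<phi> \<otimes> id \<otimes> id\<close> to the coassociativity of \<open>\<psi>\<close>.\<close>

lemma (in right_comodule) cofree_comodule_map:
  assumes P: "M.subspace P" and \<phi>: "Vector_Spaces.linear scM scM \<phi>" "range \<phi> \<subseteq> P"
  shows "comodule_map sc (whole scM) \<psi> (tensor (subsp scM P) (whole sc)) (cofree_coaction sc \<Delta> (subsp scM P))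
    (\<lambda>m. tmap (subsp scM P) (whole sc) \<phi> id (\<psi> m))"
proof -
  let ?P = "subsp scM P" and ?M = "whole scM" and ?S = "whole sc"
  let ?PS = "tensor ?P ?S" and ?MS = "tensor ?M ?S" and ?SS = "tensor ?S ?S"
  let ?h = "\<lambda>m. tmap ?P ?S \<phi> id (\<psi> m)"
  have phi: "vlinear ?M ?P \<phi>"
    using \<phi> by (auto simp: vlinear_def Vector_Spaces.linear_iff)
  note phi_id = tmap_tcls[OF phi vlinear_id[of ?S]]
  have lin: "vlinear ?MS ?PS (tmap ?P ?S \<phi> id)" by (rule tmap_vlinear[OF phi vlinear_id])
  have coact: "cofree_coaction sc \<Delta> ?P (?h m) = tmap ?PS ?S ?h id (\<psi> m)" for m
  proof -
    let ?p = "rep (\<psi> m)"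
    have "tmap ?MS ?S \<psi> id (\<psi> m) = tcls ?MS ?S (lin_ext fscale (\<lambda>(a, b). bas (\<psi> a, b)) ?p)"
      using tmap_tcls[OF coact_linear vlinear_id[of ?S], of ?p] by (simp add: coact_rep)
    moreover have "tmap ?M ?SS id \<Delta> (\<psi> m) = tcls ?M ?SS (lin_ext fscale (\<lambda>(a, b). bas (a, \<Delta> b)) ?p)"
      using tmap_tcls[OF vlinear_id[of ?M] \<Sigma>.comult_linear, of ?p] by (simp add: coact_rep)
    ultimately have "tcls ?MS ?S (lin_ext fscale (\<lambda>(a, b). bas (\<psi> a, b)) ?p) =
       tcls ?MS ?S (lin_ext fscale (\<lambda>(v, Y). lin_ext fscale (\<lambda>(w, u). bas (pure ?M ?S v w, u)) (rep Y))
         (lin_ext fscale (\<lambda>(a, b). bas (a, \<Delta> b)) ?p))"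
      using coact_coassoc[of m] by (simp add: tassoc_tcls)
    from arg_cong[OF this, of "tmap ?PS ?S (tmap ?P ?S \<phi> id) id"]
    have "tcls ?PS ?S (lin_ext fscale (\<lambda>(a, b). bas (?h a, b)) ?p) =
       tcls ?PS ?S (lin_ext fscale (\<lambda>(a, b). lin_ext fscale (\<lambda>(w, u). bas (pure ?P ?S (\<phi> a) w, u)) (rep (\<Delta> b))) ?p)"
      unfolding tmap_tcls[OF lin vlinear_id[of ?S]]
      by (simp add: lin_ext_lin_ext vector_space_fscale case_prod_beta' pure_def phi_id)
    moreover have "tmap ?PS ?S ?h id (\<psi> m) = tcls ?PS ?S (lin_ext fscale (\<lambda>(a, b). bas (?h a, b)) ?p)"
      using tmap_tcls[OF vlinear_comp[OF coact_linear lin] vlinear_id[of ?S], of ?p] by (simp add: coact_rep)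
    moreover have "cofree_coaction sc \<Delta> ?P (?h m) =
       tcls ?PS ?S (lin_ext fscale (\<lambda>(a, b). lin_ext fscale (\<lambda>(w, u). bas (pure ?P ?S (\<phi> a) w, u)) (rep (\<Delta> b))) ?p)"
    proof -
      have "?h m = tcls ?P ?S (lin_ext fscale (\<lambda>(a, b). bas (\<phi> a, b)) ?p)"
        using phi_id[of ?p] by (simp add: coact_rep)
      then show ?thesis
        unfolding cofree_coaction_def
        by (simp add: tmap_tcls[OF vlinear_id[of ?P] \<Sigma>.comult_linear] tassoc_tcls[OF subsp_vclosed[OF vsM P]]
            lin_ext_lin_ext vector_space_fscale case_prod_beta')
    qed
    ultimately show ?thesis by simp
  qed
  show ?thesis
    unfolding comodule_map_def by (intro conjI ballI vlinear_comp[OF coact_linear lin] coact)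
qed

section \<open>Comodule algebras with grouplike group elements\<close>

text \<open>A comodule algebra over a pointed bialgebra whose grouplike elements form the group \<open>G\<close>, with \<open>G\<close>
  grouplike in the comodule algebra. The group is written additively.\<close>

locale grouplike_comodule_algebra = comodule_group_algebra sc \<Delta> \<epsilon> scM \<psi> \<eta>
  for sc :: "'k::field \<Rightarrow> 's::ring_1 \<Rightarrow> 's" and \<Delta> \<epsilon>
    and scM :: "'k \<Rightarrow> 'm::ring_1 \<Rightarrow> 'm" and \<psi> and \<eta> :: "('g::group_add \<Rightarrow>\<^sub>0 'k) \<Rightarrow> 'm" +
  fixes \<iota> :: "('g \<Rightarrow>\<^sub>0 'k) \<Rightarrow> 's"
  assumes iota_map: "algebra_map fscale sc \<iota>" and iota_inj: "inj \<iota>"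
    and iota_bij: "bij_betw (\<lambda>g. \<iota> (bas g)) UNIV (grouplikes sc \<Delta> \<epsilon>)"
    and eta_grouplike: "\<psi> (\<eta> (bas g)) = pure (whole scM) (whole sc) (\<eta> (bas g)) (\<iota> (bas g))"
    and pointed: "pointed sc \<Delta>"
    and exhaustive: "exhaustive_corad_filt sc \<Delta>"
begin

text \<open>The images of a group element in the bialgebra and in the comodule algebra.\<close>

abbreviation "gS g \<equiv> \<iota> (bas g)"
abbreviation "gM g \<equiv> \<eta> (bas g)"

lemma ualgM: "unital_algebra scM" and ualgS: "unital_algebra sc"
  by unfold_locales

lemma bas_mult: "bas g * bas h = (bas (g + h) :: 'g \<Rightarrow>\<^sub>0 'k)"
  by (simp add: bas_def mult_single)

lemma bas_zero: "(bas 0 :: 'g \<Rightarrow>\<^sub>0 'k) = 1"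
  by (simp add: bas_def)

lemma gS_mult: "gS g * gS h = gS (g + h)" and gS_zero: "gS 0 = 1"
  using iota_map unfolding algebra_map_def by (metis bas_mult, metis bas_zero)

lemma gM_mult: "gM g * gM h = gM (g + h)" and gM_zero: "gM 0 = 1"
  using structure_map unfolding algebra_map_def by (metis bas_mult, metis bas_zero)

lemma GL_range: "\<Sigma>.GL = range gS"
  using iota_bij by (simp add: bij_betw_def)

lemma gS_GL: "gS g \<in> \<Sigma>.GL"
  by (simp add: GL_range)

lemma inj_gS: "inj gS"
  using iota_bij by (simp add: bij_betw_def)

lemma independent_grouplikes: "\<Sigma>.independent \<Sigma>.GL"
proof -
  interpret i: Vector_Spaces.linear fscale sc \<iota>
    using iota_map by (simp add: algebra_map_def)
  have "fs.independent (range (bas :: 'g \<Rightarrow> 'g \<Rightarrow>\<^sub>0 'k))"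
    unfolding fs.independent_explicit_module
  proof (intro allI impI)
    fix t u and v :: "'g \<Rightarrow>\<^sub>0 'k"
    assume t: "finite t" "t \<subseteq> range bas" "(\<Sum>v\<in>t. fscale (u v) v) = 0" "v \<in> t"
    then obtain b where b: "v = bas b" by auto
    have "0 = Poly_Mapping.lookup (\<Sum>v\<in>t. fscale (u v) v) b" using t(3) by simp
    also have "\<dots> = (\<Sum>w\<in>t. u w * Poly_Mapping.lookup w b)" by (simp add: lookup_sum)
    also have "\<dots> = (\<Sum>w\<in>t. if w = v then u w else 0)"
    proof (rule sum.cong)
      fix w assume "w \<in> t"
      then obtain b' where w: "w = bas b'" using t(2) by auto
      have "w = v \<longleftrightarrow> b' = b" unfolding w b by (metis keys_bas singleton_inject)
      then show "u w * Poly_Mapping.lookup w b = (if w = v then u w else 0)"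
        by (simp add: w bas_def lookup_single when_def)
    qed simp
    also have "\<dots> = u v" using t(1,4) by simp
    finally show "u v = 0" by simp
  qed
  then have "\<Sigma>.independent (\<iota> ` range bas)"
    by (rule i.independent_injective_image) (rule inj_on_subset[OF iota_inj subset_UNIV])
  then show ?thesis by (simp add: GL_range image_image)
qed

sublocale C: grouplike_coords sc \<Delta> \<epsilon>
  by unfold_locales (rule independent_grouplikes)

text \<open>The primitives, the tensor product \<open>P\<^sub>1(M) \<otimes> \<Sigma>\<close>, and the class of a formal sum in it.\<close>

abbreviation "P \<equiv> primitives sc scM \<psi>"
abbreviation "PS \<equiv> tensor (subsp scM P) (whole sc)"
abbreviation "tP \<equiv> tcls (subsp scM P) (whole sc)"

lemma coact_mult_pure: "\<psi> x = pure (whole scM) (whole sc) x a \<Longrightarrow> \<psi> y = pure (whole scM) (whole sc) y b \<Longrightarrow>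
   \<psi> (x * y) = pure (whole scM) (whole sc) (x * y) (a * b)"
  by (simp add: coact_mult tmult_pure_pure[OF ualgM ualgS])

lemma primitives_iff: "m \<in> P \<longleftrightarrow> (\<forall>\<beta>. linfun sc \<beta> \<longrightarrow> act \<beta> m = scM (\<beta> 1) m)"
  unfolding primitives_def using act_pure coact_pureI by blast

lemma subspace_primitives: "M.subspace P"
proof -
  have "M.subspace {m. act \<beta> m - scM (\<beta> 1) m = 0}" if "linfun sc \<beta>" for \<beta>
  proof -
    interpret a: Vector_Spaces.linear scM scM "act \<beta>" by (rule act_linear[OF that])
    show ?thesis
      by (rule M.subspaceI) (simp_all add: a.add a.scale M.scale_right_distrib mult.commute)
  qed
  moreover have "P = (\<Inter>\<beta>\<in>Collect (linfun sc). {m. act \<beta> m - scM (\<beta> 1) m = 0})"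
    by (auto simp: primitives_iff)
  ultimately show ?thesis by (simp only:) (intro M.subspace_Int, simp)
qed

lemma primitive_times: "p \<in> P \<Longrightarrow> \<psi> (p * gM g) = pure (whole scM) (whole sc) (p * gM g) (gS g)"
  using coact_mult_pure[of p 1 "gM g" "gS g"] by (simp add: primitives_def eta_grouplike)

lemma times_primitive:
  assumes "\<psi> m = pure (whole scM) (whole sc) m (gS g)" shows "m * gM (- g) \<in> P"
  using coact_mult_pure[OF assms eta_grouplike[of "- g"]] by (simp add: primitives_def gS_mult gS_zero)

text \<open>A linear retraction \<open>\<phi>\<close> onto the primitives with \<open>\<phi>(p g) = p\<close>. Choose a linear map \<open>\<chi>\<close> from \<open>\<Sigma>\<close> to \<open>M\<close>
  with \<open>\<chi>(g) = g\<^sup>-\<^sup>1\<close>. Then \<open>m \<mapsto> m\<^sub>0 \<chi>(m\<^sub>1)\<close>, in Sweedler notation for the coaction, sends \<open>p g\<close> to \<open>p\<close>; it is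
  composed with a linear projection onto the primitives.\<close>

lemma retraction_exists:
  obtains \<phi> where "Vector_Spaces.linear scM scM \<phi>" "range \<phi> \<subseteq> P" "\<And>p g. p \<in> P \<Longrightarrow> \<phi> (p * gM g) = p"
proof -
  interpret SM: vector_space_pair sc scM by unfold_locales
  interpret MM: vector_space_pair scM scM by unfold_locales
  obtain \<chi> where \<chi>: "Vector_Spaces.linear sc scM \<chi>" "\<forall>s\<in>\<Sigma>.GL. \<chi> s = gM (- inv gS s)"
    using SM.linear_independent_extend[OF independent_grouplikes, of "\<lambda>s. gM (- inv gS s)"] by blast
  interpret chi: Vector_Spaces.linear sc scM \<chi> by fact
  have chi_g: "\<chi> (gS g) = gM (- g)" for g
    using \<chi>(2) gS_GL by (simp add: inv_f_f[OF inj_gS])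
  let ?B = "\<lambda>(a, b). a * \<chi> b"
  have bil: "bilin_mod (whole scM) (whole sc) scM {0} ?B"
    by (simp add: bilin_mod_def chi.add chi.scale distrib_left distrib_right M.scale_mult_left M.scale_mult_right)
  note ev = lin_ext_rep_tcls[OF vsM bil]
  define \<phi>0 where "\<phi>0 m = lin_ext scM ?B (rep (\<psi> m))" for m
  have "vlinear (tensor (whole scM) (whole sc)) (whole scM) (\<lambda>X. lin_ext scM ?B (rep X))"
    by (auto simp: vlinear_def tensor_simps ev lin_ext_add lin_ext_scale vsM)
  from vlinear_comp[OF coact_linear this] have lin0: "Vector_Spaces.linear scM scM \<phi>0"
    unfolding vlinear_whole[OF vsM vsM] \<phi>0_def[abs_def] .
  have phi0: "\<phi>0 (p * gM g) = p" if "p \<in> P" for p g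
    using ev[of "bas (p * gM g, gS g)"]
    by (simp add: \<phi>0_def primitive_times[OF that] pure_def vsM chi_g mult.assoc gM_mult gM_zero)
  obtain \<pi> where \<pi>: "range \<pi> \<subseteq> P" "Vector_Spaces.linear scM scM \<pi>" "\<forall>v\<in>P. \<pi> v = v"
    using MM.linear_exists_left_inverse_on[OF M.linear_id subspace_primitives] by auto
  show ?thesis
  proof (rule that[of "\<pi> \<circ> \<phi>0"])
    show "Vector_Spaces.linear scM scM (\<pi> \<circ> \<phi>0)"
      by (rule Vector_Spaces.linear_compose[OF lin0 \<pi>(2)])
    show "range (\<pi> \<circ> \<phi>0) \<subseteq> P" using \<pi>(1) by auto
    show "(\<pi> \<circ> \<phi>0) (p * gM g) = p" if "p \<in> P" for p g
      using \<pi>(3) phi0[OF that] that by simp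
  qed
qed

text \<open>The analogue of \<open>lact_decomp\<close> for the comodule.\<close>

lemma act_decomp:
  obtains A \<gamma> where "finite A" "A \<subseteq> \<Sigma>.GL" "\<gamma> \<in> \<Sigma>.perp" "m = (\<Sum>g\<in>A. act (C.coord g) m) + act \<gamma> m"
proof -
  obtain A \<gamma> where A: "finite A" "A \<subseteq> \<Sigma>.GL" "\<gamma> \<in> \<Sigma>.perp"
      "\<And>d. d \<in> snd ` Poly_Mapping.keys (rep (\<psi> m)) \<Longrightarrow> \<epsilon> d = (\<Sum>g\<in>A. C.coord g d) + \<gamma> d"
    using C.counit_decomp[of "snd ` Poly_Mapping.keys (rep (\<psi> m))"] by auto
  have "m = act \<epsilon> m" by (simp add: act_counit)
  also have "\<dots> = act (\<lambda>x. (\<Sum>g\<in>A. C.coord g x) + \<gamma> x) m"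
    unfolding act_def contract_right_def
  proof (rule lin_ext_cong)
    fix k assume k: "k \<in> Poly_Mapping.keys (rep (\<psi> m))"
    obtain a b where ab: "k = (a, b)" by (cases k)
    have "\<epsilon> b = (\<Sum>g\<in>A. C.coord g b) + \<gamma> b"
      by (rule A(4)) (use k ab in force)
    then show "(\<lambda>(a, b). scM (\<epsilon> b) a) k = (\<lambda>(a, b). scM ((\<Sum>g\<in>A. C.coord g b) + \<gamma> b) a) k"
      by (simp add: ab)
  qed
  also have "\<dots> = (\<Sum>g\<in>A. act (C.coord g) m) + act \<gamma> m"
    by (subst act_fun_add, subst act_fun_sum, rule refl)
  finally show ?thesis by (rule that[OF A(1-3)])
qed

text \<open>On elements killed by \<open>perp\<close> the components are homogeneous: \<open>\<psi>(m\<^sub>g) = m\<^sub>g \<otimes> g\<close>.\<close>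

lemma act_coord:
  assumes "m \<in> filt (Suc 0)" "g \<in> \<Sigma>.GL"
  shows "\<psi> (act (C.coord g) m) = pure (whole scM) (whole sc) (act (C.coord g) m) g"
proof (rule coact_pureI)
  fix \<beta> assume \<beta>: "linfun sc \<beta>"
  let ?\<gamma> = "\<lambda>x. conv \<Delta> \<beta> (C.coord g) x - \<beta> g * C.coord g x"
  have lin: "linfun sc ?\<gamma>"
    by (rule linfun_diff_scale[OF conv_linear[OF \<beta> C.coord_linfun] C.coord_linfun])
  have "?\<gamma> \<in> \<Sigma>.perp"
    using lin by (auto simp: \<Sigma>.perp_def \<Sigma>.conv_GL \<beta> C.coord_linfun C.coord_GL)
  then have "act ?\<gamma> m = 0" using assms(1) by (auto simp: filt_Suc filt_0)
  moreover have "act ?\<gamma> m = act (conv \<Delta> \<beta> (C.coord g)) m - scM (\<beta> g) (act (C.coord g) m)"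
    by (subst act_fun_diff, subst act_fun_scale, rule refl)
  ultimately show "act \<beta> (act (C.coord g) m) = scM (\<beta> g) (act (C.coord g) m)"
    by (simp add: act_act[OF \<beta> C.coord_linfun])
qed

text \<open>Every element has only finitely many coefficients, so exhaustiveness passes from \<open>\<Sigma>\<close> to \<open>M\<close>.\<close>

lemma filt_exhaustive: "\<exists>n. m \<in> filt n"
proof -
  have "\<exists>n. finite D \<longrightarrow> D \<subseteq> \<Sigma>.S.filt n" for D
  proof (cases "finite D")
    case True
    then show ?thesis
    proof (induction rule: finite_induct)
      case (insert x D)
      then obtain n where n: "D \<subseteq> \<Sigma>.S.filt n" by auto
      obtain k where k: "x \<in> \<Sigma>.S.filt (Suc k)"
        using exhaustive unfolding exhaustive_corad_filt_def \<Sigma>.corad_filt_pointed[OF pointed] by blast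
      have "insert x D \<subseteq> \<Sigma>.S.filt (max n (Suc k))"
        using n k \<Sigma>.S.filt_mono[of n "max n (Suc k)"] \<Sigma>.S.filt_mono[of "Suc k" "max n (Suc k)"] by auto
      then show ?case by blast
    qed auto
  qed auto
  then obtain n where "snd ` Poly_Mapping.keys (rep (\<psi> m)) \<subseteq> \<Sigma>.S.filt n"
    by (meson finite_imageI finite_keys)
  from filt_if_coeffs[OF coact_rep[symmetric] this] show ?thesis ..
qed

text \<open>The kernel of the comodule map induced by a retraction is zero. The hypothesis on \<open>m\<close> is
  inherited by all \<open>act \<alpha> m\<close>, so by induction along the filtration all functionals in \<open>perp\<close> kill \<open>m\<close>.\<close>

lemma retraction_injective:
  assumes \<phi>: "\<And>p g. p \<in> P \<Longrightarrow> \<phi> (p * gM g) = p"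
    and z: "\<And>\<beta>. linfun sc \<beta> \<Longrightarrow> \<phi> (act \<beta> m) = 0"
  shows "m = 0"
proof -
  obtain n where "m \<in> filt n" using filt_exhaustive by blast
  then show ?thesis using z
  proof (induction n arbitrary: m)
    case (Suc n)
    have "act \<alpha> m = 0" if \<alpha>: "\<alpha> \<in> \<Sigma>.perp" for \<alpha>
    proof (rule Suc.IH)
      show "act \<alpha> m \<in> filt n" using Suc.prems(1) \<alpha> by (simp add: filt_Suc)
      show "\<phi> (act \<beta> (act \<alpha> m)) = 0" if "linfun sc \<beta>" for \<beta>
        using Suc.prems(2)[OF conv_linear[OF that \<Sigma>.perp_linfun[OF \<alpha>]]]
        by (simp add: act_act[OF that \<Sigma>.perp_linfun[OF \<alpha>]])
    qed
    then have m1: "m \<in> filt (Suc 0)" and perp0: "\<And>\<alpha>. \<alpha> \<in> \<Sigma>.perp \<Longrightarrow> act \<alpha> m = 0" by (simp_all add: filt_Suc filt_0)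
    have coord0: "act (C.coord s) m = 0" if s: "s \<in> \<Sigma>.GL" for s
    proof -
      obtain g where g: "s = gS g" using s GL_range by auto
      let ?m = "act (C.coord s) m"
      let ?p = "?m * gM (- g)"
      have "?p \<in> P" using act_coord[OF m1 s] by (intro times_primitive) (simp add: g)
      moreover have "?m = ?p * gM g" by (simp add: mult.assoc gM_mult gM_zero)
      ultimately have "\<phi> ?m = ?p" using \<phi> by metis
      with Suc.prems(2)[OF C.coord_linfun] have "?p = 0" by simp
      with \<open>?m = ?p * gM g\<close> show ?thesis by simp
    qed
    obtain A \<gamma> where A: "A \<subseteq> \<Sigma>.GL" "\<gamma> \<in> \<Sigma>.perp" "m = (\<Sum>g\<in>A. act (C.coord g) m) + act \<gamma> m"
      using act_decomp[of m] by metis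
    have "(\<Sum>g\<in>A. act (C.coord g) m) = 0"
      by (rule sum.neutral) (use A(1) coord0 in blast)
    then show ?case using A(3) perp0[OF A(2)] by simp
  qed (simp add: filt_0)
qed

end

section \<open>The isomorphism with the cofree comodule\<close>

context grouplike_comodule_algebra
begin

lemma tP_pure_add:
  "p \<in> P \<Longrightarrow> tP (bas (p, x + y)) = tP (bas (p, x) + bas (p, y))"
  "p \<in> P \<Longrightarrow> tP (bas (p, sc c x)) = tP (fscale c (bas (p, x)))"
  using tcls_bilinear(2)[of p "subsp scM P" x "whole sc" y] tcls_bilinear(4)[of p "subsp scM P" x "whole sc" c]
  by (simp_all add: tcls_eq_iff diff_diff_eq)

text \<open>The comodule map induced by a retraction is bijective as soon as graded left primitives of \<open>\<Sigma>\<close> lift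
  along some unit-preserving comodule map \<open>f\<close>.\<close>

lemma retraction_iso:
  assumes \<phi>: "Vector_Spaces.linear scM scM \<phi>" "range \<phi> \<subseteq> P" "\<And>p g. p \<in> P \<Longrightarrow> \<phi> (p * gM g) = p"
    and f: "comodule_map sc (whole scM) \<psi> (whole sc) \<Delta> f" "f 1 = 1"
      "\<And>n. graded_left_primitives sc \<Delta> sc \<Delta> 1 n \<subseteq> f ` graded_left_primitives sc \<Delta> scM \<psi> 1 n"
  defines "h \<equiv> \<lambda>m. tmap (subsp scM P) (whole sc) \<phi> id (\<psi> m)"
  shows "bij_betw h UNIV (vcarrier PS)"
proof -
  interpret phi: Vector_Spaces.linear scM scM \<phi> by fact
  have phiP: "\<phi> m \<in> P" for m using \<phi>(2) by auto
  have phi: "vlinear (whole scM) (subsp scM P) \<phi>"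
    using phiP by (auto simp: vlinear_def phi.add phi.scale)
  note phi_id = tmap_tcls[OF phi vlinear_id[of "whole sc"]]
  have hlin: "vlinear (whole scM) PS h"
    unfolding h_def by (rule vlinear_comp[OF coact_linear tmap_vlinear[OF phi vlinear_id]])
  have h_tcls: "h m = tP (lin_ext fscale (\<lambda>(a, b). bas (\<phi> a, b)) q)"
    if "\<psi> m = tcls (whole scM) (whole sc) q" for m q
    using phi_id[of q] that by (simp add: h_def)
  have h_contract: "contract_right scM \<beta> (h m) = \<phi> (act \<beta> m)" if "linfun sc \<beta>" for \<beta> m
  proof -
    have "contract_right scM \<beta> (h m) = lin_ext scM (\<lambda>(a, b). scM (\<beta> b) (\<phi> a)) (rep (\<psi> m))"
      using h_tcls[OF coact_rep[symmetric], of m]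
      by (simp add: contract_right_tcls[OF vsM that] lin_ext_lin_ext vsM case_prod_beta')
    also have "\<dots> = \<phi> (act \<beta> m)"
      unfolding act_def contract_right_def linear_lin_ext[OF \<phi>(1)]
      by (rule lin_ext_cong) (auto simp: phi.scale)
    finally show ?thesis .
  qed
  have "inj h"
  proof (rule injI)
    fix m m' assume "h m = h m'"
    then have eq: "\<phi> (act \<beta> m) = \<phi> (act \<beta> m')" if "linfun sc \<beta>" for \<beta>
      using h_contract[OF that, of m] h_contract[OF that, of m'] by simp
    have "m - m' = 0"
    proof (rule retraction_injective[OF \<phi>(3)])
      fix \<beta> assume \<beta>: "linfun sc \<beta>"
      interpret a: Vector_Spaces.linear scM scM "act \<beta>" by (rule act_linear[OF \<beta>])
      show "\<phi> (act \<beta> (m - m')) = 0"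
        using eq[OF \<beta>] by (simp add: a.diff phi.diff)
    qed
    then show "m = m'" by simp
  qed
  moreover have "range h = vcarrier PS"
  proof
    show "range h \<subseteq> vcarrier PS" using hlin by (auto simp: vlinear_def)
    (* J is the preimage of the image of h in the space of formal sums. *)
    define J where "J = {q. tP q \<in> range h}"
    have J: "module.subspace fscale J"
    proof (rule fs.subspaceI)
      have "act \<beta> 0 = 0" if "linfun sc \<beta>" for \<beta>
        by (rule module_hom.zero[OF act_linear[OF that, unfolded linear_iff_module_hom]])
      then have "\<psi> 0 = tcls (whole scM) (whole sc) 0" by (intro coact_separate) simp
      then have "tP 0 = h 0" using h_tcls[of 0 0] by simp
      then show "0 \<in> J" by (simp add: J_def)
      show "x + y \<in> J" if "x \<in> J" "y \<in> J" for x y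
      proof -
        obtain m m' where "tP x = h m" "tP y = h m'" using \<open>x \<in> J\<close> \<open>y \<in> J\<close> by (auto simp: J_def)
        then have "tP (x + y) = h (m + m')"
          using hlin by (simp add: vlinear_def tensor_simps(2)[symmetric])
        then show ?thesis by (simp add: J_def)
      qed
      show "fscale c x \<in> J" if "x \<in> J" for c x
      proof -
        obtain m where "tP x = h m" using \<open>x \<in> J\<close> by (auto simp: J_def)
        then have "tP (fscale c x) = h (scM c m)"
          using hlin by (simp add: vlinear_def tensor_simps(3)[symmetric])
        then show ?thesis by (simp add: J_def)
      qed
    qed
    have JP: "\<Sigma>.subspace {y. bas (p, y) \<in> J}" if "p \<in> P" for p
    proof (rule \<Sigma>.subspaceI)
      show "0 \<in> {y. bas (p, y) \<in> J}"
        using tP_pure_add(2)[OF that, of 0 0] fs.subspace_0[OF J] by (simp add: J_def)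
      show "x + y \<in> {y. bas (p, y) \<in> J}" if "x \<in> {y. bas (p, y) \<in> J}" "y \<in> {y. bas (p, y) \<in> J}" for x y
        using fs.subspace_add[OF J, of "bas (p, x)" "bas (p, y)"] that tP_pure_add(1)[OF \<open>p \<in> P\<close>, of x y]
        by (simp add: J_def)
      show "sc c x \<in> {y. bas (p, y) \<in> J}" if "x \<in> {y. bas (p, y) \<in> J}" for c x
        using fs.subspace_scale[OF J, of "bas (p, x)" c] that tP_pure_add(2)[OF \<open>p \<in> P\<close>, of c x]
        by (simp add: J_def)
    qed
    have main: "bas (p, x) \<in> J" if "x \<in> \<Sigma>.S.filt n" "p \<in> P" for n x p
      using that
    proof (induction n arbitrary: x p)
      case 0
      then show ?case using \<Sigma>.subspace_0[OF JP[OF 0(2)]] by (simp add: \<Sigma>.S.filt_0)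
    next
      case (Suc n)
      let ?K = "{y. bas (p, y) \<in> J}"
      note K = JP[OF Suc.prems(2)]
      have filtK: "y \<in> ?K" if "y \<in> \<Sigma>.S.filt n" for y using Suc.IH[OF that Suc.prems(2)] by simp
      (* The component at s = gS k, translated to the unit, lifts to a graded left primitive m of M;
         the element p * gM k * m then hits p \<otimes> x\<^sub>s up to terms covered by the induction hypothesis. *)
      have comp: "\<Sigma>.lact (C.coord s) x \<in> ?K" if s: "s \<in> \<Sigma>.GL" for s
      proof -
        obtain k where k: "s = gS k" using s GL_range by auto
        let ?y = "\<Sigma>.lact (C.coord s) x"
        let ?b = "gS (- k) * ?y"
        have "?b \<in> graded_left_primitives sc \<Delta> sc \<Delta> 1 n"
          by (rule graded_left_primitive_component[OF \<Sigma>.bialgebra_axioms C.grouplike_coords_axioms pointed s gS_GL _ Suc.prems(1)])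
            (simp add: k gS_mult gS_zero)
        then obtain m where m: "m \<in> graded_left_primitives sc \<Delta> scM \<psi> 1 n" "f m = ?b"
          using f(3)[of n] by auto
        then obtain \<sigma> t where t: "\<sigma> \<in> \<Sigma>.S.filt (Suc n)" "Poly_Mapping.keys t \<subseteq> UNIV \<times> \<Sigma>.S.filt n"
          "\<psi> m = vadd (tensor (whole scM) (whole sc)) (pure (whole scM) (whole sc) 1 \<sigma>) (tcls (whole scM) (whole sc) t)"
          by (auto simp: graded_left_primitives_def tensor_image_def \<Sigma>.corad_filt_pointed[OF pointed]
              \<Sigma>.corad_filt_pred_pointed[OF pointed])
        have psi_m: "\<psi> m = tcls (whole scM) (whole sc) (bas (1, \<sigma>) + t)"
          unfolding t(3) by (simp add: pure_def tensor_simps)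
        have "\<Delta> ?b = tmap (whole sc) (whole sc) f id (\<psi> m)"
          unfolding m(2)[symmetric] using f(1) by (simp add: comodule_map_def)
        also have "\<dots> = tcls (whole sc) (whole sc) (bas (1, \<sigma>) + lin_ext fscale (\<lambda>(a, b). bas (f a, b)) t)"
          unfolding psi_m using tmap_tcls[OF _ vlinear_id[of "whole sc"], of "whole scM" "whole sc" f "bas (1, \<sigma>) + t"] f(1,2)
          by (simp add: comodule_map_def lin_ext_add vector_space_fscale)
        (* Applying the counit to the first factor shows \<sigma> \<equiv> ?b modulo filt n. *)
        finally have "\<Sigma>.lact \<epsilon> ?b = \<sigma> + lin_ext sc (\<lambda>(a, b). sc (\<epsilon> (f a)) b) t"
          unfolding \<Sigma>.lact_def
          by (simp add: contract_left_tcls[OF vsS \<Sigma>.counit_linear] lin_ext_add lin_ext_lin_ext vsS \<Sigma>.counit_one case_prod_beta')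
        then have "\<sigma> - ?b = - lin_ext sc (\<lambda>(a, b). sc (\<epsilon> (f a)) b) t"
          by (simp add: \<Sigma>.lact_counit)
        also have "\<dots> \<in> \<Sigma>.S.filt n"
          by (intro \<Sigma>.subspace_neg \<Sigma>.S.filt_subspace lin_ext_in_subspace[OF vsS])
            (use t(2) \<Sigma>.subspace_scale[OF \<Sigma>.S.filt_subspace] in auto)
        finally have "gS k * (\<sigma> - ?b) \<in> \<Sigma>.S.filt n" by (rule \<Sigma>.filt_translate[OF gS_GL])
        then have diff: "gS k * \<sigma> - ?y \<in> ?K"
          by (intro filtK) (simp add: right_diff_distrib mult.assoc[symmetric] gS_mult gS_zero)
        let ?u = "p * gM k"
        let ?r = "lin_ext fscale (\<lambda>(c, d). bas (\<phi> (?u * c), gS k * d)) t"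
        have "\<psi> (?u * m) = tcls (whole scM) (whole sc)
            (lin_ext fscale (\<lambda>(c, d). bas (?u * c, gS k * d)) (bas (1, \<sigma>) + t))"
          unfolding coact_mult[of ?u m] primitive_times[OF Suc.prems(2)] psi_m by (rule tmult_pure[OF ualgM ualgS])
        from h_tcls[OF this] have "h (?u * m) = tP (bas (p, gS k * \<sigma>) + ?r)"
          using \<phi>(3)[OF Suc.prems(2), of k]
          by (simp add: lin_ext_add lin_ext_lin_ext vector_space_fscale case_prod_beta')
        then have "bas (p, gS k * \<sigma>) + ?r \<in> J"
          unfolding J_def by (metis mem_Collect_eq rangeI)
        moreover have "?r \<in> J"
          by (rule lin_ext_in_subspace[OF vector_space_fscale J])
            (use t(2) Suc.IH \<Sigma>.filt_translate[OF gS_GL] phiP in auto)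
        ultimately have "gS k * \<sigma> \<in> ?K"
          using fs.subspace_diff[OF J, of "bas (p, gS k * \<sigma>) + ?r" ?r] by simp
        from \<Sigma>.subspace_diff[OF K this diff] show ?thesis by simp
      qed
      obtain A \<gamma> where A: "A \<subseteq> \<Sigma>.GL" "\<gamma> \<in> \<Sigma>.perp" "x = (\<Sum>g\<in>A. \<Sigma>.lact (C.coord g) x) + \<Sigma>.lact \<gamma> x"
        using C.lact_decomp[of x] by metis
      have "(\<Sum>g\<in>A. \<Sigma>.lact (C.coord g) x) + \<Sigma>.lact \<gamma> x \<in> ?K"
        by (intro \<Sigma>.subspace_add[OF K] \<Sigma>.subspace_sum[OF K])
          (use A(1) comp filtK[OF \<Sigma>.lact_perp_filt[OF A(2) Suc.prems(1)]] in blast)+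
      then show ?case using A(3) by simp
    qed
    show "vcarrier PS \<subseteq> range h"
    proof
      fix X assume "X \<in> vcarrier PS"
      then obtain q where q: "X = tP q" "Poly_Mapping.keys q \<subseteq> P \<times> UNIV" by (auto simp: tensor_simps)
      have "lin_ext fscale bas q \<in> J"
      proof (rule lin_ext_in_subspace[OF vector_space_fscale J])
        fix z assume "z \<in> Poly_Mapping.keys q"
        then obtain p x where z: "z = (p, x)" "p \<in> P" using q(2) by auto
        obtain k where "x \<in> \<Sigma>.S.filt (Suc k)"
          using exhaustive unfolding exhaustive_corad_filt_def \<Sigma>.corad_filt_pointed[OF pointed] by blast
        then show "bas z \<in> J" unfolding z(1) by (rule main) (rule z(2))
      qed
      then show "X \<in> range h" by (simp add: lin_ext_bas_self q(1) J_def)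
    qed
  qed
  ultimately show ?thesis by (simp add: bij_betw_def)
qed

end

theorem theorem2p8:
  fixes scS :: "'k::field \<Rightarrow> 's::ring_1 \<Rightarrow> 's"
    and \<Delta> :: "'s \<Rightarrow> (('s \<times> 's) \<Rightarrow>\<^sub>0 'k) set"
    and \<epsilon> :: "'s \<Rightarrow> 'k"
    and \<iota> :: "('g::group_add \<Rightarrow>\<^sub>0 'k) \<Rightarrow> 's"
    and scM :: "'k \<Rightarrow> 'm::ring_1 \<Rightarrow> 'm"
    and \<psi> :: "'m \<Rightarrow> (('m \<times> 's) \<Rightarrow>\<^sub>0 'k) set"
    and \<eta> :: "('g \<Rightarrow>\<^sub>0 'k) \<Rightarrow> 'm"
    and f :: "'m \<Rightarrow> 's"
  assumes "bialgebra scS \<Delta> \<epsilon>"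
    and "pointed scS \<Delta>"
    and "exhaustive_corad_filt scS \<Delta>"
    and "algebra_map fscale scS \<iota>"
    and "inj \<iota>"
    and "bij_betw (\<lambda>g. \<iota> (bas g)) UNIV (grouplikes scS \<Delta> \<epsilon>)"
    and "comodule_group_algebra scS \<Delta> \<epsilon> scM \<psi> \<eta>"
    and "\<forall>g. \<psi> (\<eta> (bas g)) = pure (whole scM) (whole scS) (\<eta> (bas g)) (\<iota> (bas g))"
    and "comodule_map scS (whole scM) \<psi> (whole scS) \<Delta> f"
    and "algebra_map scM scS f"
    and "\<forall>a. f (\<eta> a) = \<iota> a"
    and "star_surjective scS \<Delta> scM \<psi> 1 scS \<Delta> 1 f"
  shows "\<exists>h. comodule_iso scS (whole scM) \<psi>
           (tensor (subsp scM (primitives scS scM \<psi>)) (whole scS))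
           (cofree_coaction scS \<Delta> (subsp scM (primitives scS scM \<psi>))) h"
proof -
  interpret comodule_group_algebra scS \<Delta> \<epsilon> scM \<psi> \<eta> by fact
  interpret grouplike_comodule_algebra scS \<Delta> \<epsilon> scM \<psi> \<eta> \<iota>
    by unfold_locales (use assms in auto)
  obtain \<phi> where \<phi>: "Vector_Spaces.linear scM scM \<phi>" "range \<phi> \<subseteq> P" "\<And>p g. p \<in> P \<Longrightarrow> \<phi> (p * gM g) = p"
    using retraction_exists by blast
  have "graded_left_primitives scS \<Delta> scS \<Delta> 1 n \<subseteq> f ` graded_left_primitives scS \<Delta> scM \<psi> 1 n" for n
    using assms(12) by (simp add: star_surjective_def)
  moreover have "f 1 = 1" using assms(10) by (simp add: algebra_map_def)
  ultimately have "bij_betw (\<lambda>m. tmap (subsp scM P) (whole scS) \<phi> id (\<psi> m)) UNIV (vcarrier PS)"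
    using retraction_iso[OF \<phi> assms(9)] by blast
  then show ?thesis
    using cofree_comodule_map[OF subspace_primitives \<phi>(1,2)]
    unfolding comodule_iso_def by auto
qed

end
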